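(* Let $k$ be a field, let $M=ka\oplus kb$ and $N=kx$ be abelian Lie algebras over $k$ with bases $a,b$ and $x$ respectively, and let $L=M*N=\langle a,b,x\mid [a,b]\rangle$, $\mathbb{N}$-graded with $a,b,x$ of degree $1$. Let $S$ be the $\mathbb{N}$-graded Lie subalgebra of $L$ generated by $a$, $b$, $z=[x,a]$ and $t=[x,b]$. Then $S\neq C*D$ for any non-zero $\mathbb{N}$-graded Lie subalgebras $C$ and $D$ of $S$.
   Context: $*$ denotes the free product (coproduct) of Lie algebras over $k$; $S=C*D$ for subalgebras $C,D$ means that the homomorphism $C*D\to S$ induced by the inclusions is an isomorphism. $\langle X\mid R\rangle$ denotes the free Lie algebra on $X$ modulo the ideal generated by $R$. A subalgebra $C$ of an $\mathbb{N}$-graded Lie algebra $S=\bigoplus_{i\ge1} S_i$ is $\mathbb{N}$-graded if $C=\bigoplus_i C\cap S_i$. *)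

theory Defs
  imports "HOL.Hull" "HOL-Algebra.Module" "HOL-Algebra.QuotRing"
begin

section \<open>Lie algebras\<close>

text \<open>
  A Lie algebra over a field is a vector space (a \<^locale>\<open>module\<close> over a field) together with an
  alternating bilinear bracket satisfying the Jacobi identity. The bracket of \<open>u\<close> and \<open>v\<close> is the
  multiplication \<open>u \<otimes> v\<close> of the underlying record; the record field \<^const>\<open>one\<close> plays no role.
\<close>

locale lie_algebra = K?: field K + L?: module K L for K (structure) and L (structure) +
  assumes bracket_closed:
      "\<lbrakk> u \<in> carrier L; v \<in> carrier L \<rbrakk> \<Longrightarrow> u \<otimes>\<^bsub>L\<^esub> v \<in> carrier L"
    and bracket_add_left:
      "\<lbrakk> u \<in> carrier L; v \<in> carrier L; w \<in> carrier L \<rbrakk> \<Longrightarrow>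
        (u \<oplus>\<^bsub>L\<^esub> v) \<otimes>\<^bsub>L\<^esub> w = u \<otimes>\<^bsub>L\<^esub> w \<oplus>\<^bsub>L\<^esub> v \<otimes>\<^bsub>L\<^esub> w"
    and bracket_add_right:
      "\<lbrakk> u \<in> carrier L; v \<in> carrier L; w \<in> carrier L \<rbrakk> \<Longrightarrow>
        u \<otimes>\<^bsub>L\<^esub> (v \<oplus>\<^bsub>L\<^esub> w) = u \<otimes>\<^bsub>L\<^esub> v \<oplus>\<^bsub>L\<^esub> u \<otimes>\<^bsub>L\<^esub> w"
    and bracket_smult_left:
      "\<lbrakk> \<alpha> \<in> carrier K; u \<in> carrier L; v \<in> carrier L \<rbrakk> \<Longrightarrow>
        (\<alpha> \<odot>\<^bsub>L\<^esub> u) \<otimes>\<^bsub>L\<^esub> v = \<alpha> \<odot>\<^bsub>L\<^esub> (u \<otimes>\<^bsub>L\<^esub> v)"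
    and bracket_smult_right:
      "\<lbrakk> \<alpha> \<in> carrier K; u \<in> carrier L; v \<in> carrier L \<rbrakk> \<Longrightarrow>
        u \<otimes>\<^bsub>L\<^esub> (\<alpha> \<odot>\<^bsub>L\<^esub> v) = \<alpha> \<odot>\<^bsub>L\<^esub> (u \<otimes>\<^bsub>L\<^esub> v)"
    and bracket_self:
      "u \<in> carrier L \<Longrightarrow> u \<otimes>\<^bsub>L\<^esub> u = \<zero>\<^bsub>L\<^esub>"
    and jacobi:
      "\<lbrakk> u \<in> carrier L; v \<in> carrier L; w \<in> carrier L \<rbrakk> \<Longrightarrow>
        u \<otimes>\<^bsub>L\<^esub> (v \<otimes>\<^bsub>L\<^esub> w) \<oplus>\<^bsub>L\<^esub> v \<otimes>\<^bsub>L\<^esub> (w \<otimes>\<^bsub>L\<^esub> u) \<oplus>\<^bsub>L\<^esub> w \<otimes>\<^bsub>L\<^esub> (u \<otimes>\<^bsub>L\<^esub> v) = \<zero>\<^bsub>L\<^esub>"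

definition lie_abelian :: "('b, 'm) ring_scheme \<Rightarrow> bool"
  where "lie_abelian L \<longleftrightarrow> (\<forall>u\<in>carrier L. \<forall>v\<in>carrier L. u \<otimes>\<^bsub>L\<^esub> v = \<zero>\<^bsub>L\<^esub>)"

text \<open>A finite basis: every vector is a linear combination with unique coefficients.\<close>

definition finite_basis ::
    "('a, 'k) ring_scheme \<Rightarrow> ('a, 'b, 'm) module_scheme \<Rightarrow> 'b set \<Rightarrow> bool"
  where "finite_basis K L B \<longleftrightarrow> finite B \<and> B \<subseteq> carrier L \<and>
    (\<forall>v\<in>carrier L. \<exists>!c. c \<in> (B \<rightarrow>\<^sub>E carrier K) \<and> v = (\<Oplus>\<^bsub>L\<^esub>u\<in>B. c u \<odot>\<^bsub>L\<^esub> u))"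

text \<open>A subalgebra \<open>H\<close> of \<open>L\<close> is regarded as a Lie algebra in its own right via
  \<open>L\<lparr>carrier := H\<rparr>\<close>.\<close>

definition lie_subalgebra ::
    "('a, 'k) ring_scheme \<Rightarrow> ('a, 'b, 'm) module_scheme \<Rightarrow> 'b set \<Rightarrow> bool"
  where "lie_subalgebra K L H \<longleftrightarrow> submodule H K L \<and> (\<forall>u\<in>H. \<forall>v\<in>H. u \<otimes>\<^bsub>L\<^esub> v \<in> H)"

definition lie_ideal ::
    "('a, 'k) ring_scheme \<Rightarrow> ('a, 'b, 'm) module_scheme \<Rightarrow> 'b set \<Rightarrow> bool"
  where "lie_ideal K L I \<longleftrightarrow> submodule I K L \<and> (\<forall>u\<in>carrier L. \<forall>v\<in>I. u \<otimes>\<^bsub>L\<^esub> v \<in> I)"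

definition lie_hom ::
    "('a, 'k) ring_scheme \<Rightarrow> ('a, 'b, 'm) module_scheme \<Rightarrow> ('a, 'c, 'n) module_scheme
      \<Rightarrow> ('b \<Rightarrow> 'c) set"
  where "lie_hom K L L' = {h \<in> carrier L \<rightarrow> carrier L'.
    (\<forall>u\<in>carrier L. \<forall>v\<in>carrier L. h (u \<oplus>\<^bsub>L\<^esub> v) = h u \<oplus>\<^bsub>L'\<^esub> h v) \<and>
    (\<forall>\<alpha>\<in>carrier K. \<forall>u\<in>carrier L. h (\<alpha> \<odot>\<^bsub>L\<^esub> u) = \<alpha> \<odot>\<^bsub>L'\<^esub> h u) \<and>
    (\<forall>u\<in>carrier L. \<forall>v\<in>carrier L. h (u \<otimes>\<^bsub>L\<^esub> v) = h u \<otimes>\<^bsub>L'\<^esub> h v)}"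

definition lie_iso ::
    "('a, 'k) ring_scheme \<Rightarrow> ('a, 'b, 'm) module_scheme \<Rightarrow> ('a, 'c, 'n) module_scheme
      \<Rightarrow> ('b \<Rightarrow> 'c) set"
  where "lie_iso K L L' = {h \<in> lie_hom K L L'. bij_betw h (carrier L) (carrier L')}"

definition lie_quot :: "('a, 'b, 'm) module_scheme \<Rightarrow> 'b set \<Rightarrow> ('a, 'b set) module"
  where "lie_quot L I =
    \<lparr> carrier = a_rcosets\<^bsub>L\<^esub> I, mult = rcoset_mult L I, one = I +>\<^bsub>L\<^esub> \<one>\<^bsub>L\<^esub>,
      zero = I, add = set_add L, smult = (\<lambda>\<alpha> A. \<Union>u\<in>A. I +>\<^bsub>L\<^esub> (\<alpha> \<odot>\<^bsub>L\<^esub> u)) \<rparr>"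


section \<open>Free Lie algebras, presentations and free products\<close>

text \<open>
  The free Lie algebra on a set \<open>X\<close> is the algebra of formal Lie expressions in the elements
  of \<open>X\<close> modulo the least congruence that enforces the axioms of a Lie algebra over \<open>K\<close>.
  Additive inverses are \<open>Scale (\<ominus> \<one>) t\<close>.
\<close>

datatype (lie_scalars: 'a, lie_gens: 'x) lie_term =
    Gen 'x
  | Null
  | Plus "('a, 'x) lie_term" "('a, 'x) lie_term"
  | Scale 'a "('a, 'x) lie_term"
  | Bracket "('a, 'x) lie_term" "('a, 'x) lie_term"

definition lie_terms :: "('a, 'k) ring_scheme \<Rightarrow> 'x set \<Rightarrow> ('a, 'x) lie_term set"
  where "lie_terms K X = {t. lie_scalars t \<subseteq> carrier K \<and> lie_gens t \<subseteq> X}"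

inductive_set lie_cong ::
    "('a, 'k) ring_scheme \<Rightarrow> 'x set \<Rightarrow> (('a, 'x) lie_term \<times> ('a, 'x) lie_term) set"
  for K (structure) and X
where
  refl: "t \<in> lie_terms K X \<Longrightarrow> (t, t) \<in> lie_cong K X"
| sym: "(s, t) \<in> lie_cong K X \<Longrightarrow> (t, s) \<in> lie_cong K X"
| trans: "\<lbrakk> (r, s) \<in> lie_cong K X; (s, t) \<in> lie_cong K X \<rbrakk> \<Longrightarrow> (r, t) \<in> lie_cong K X"
| cong_plus: "\<lbrakk> (s, s') \<in> lie_cong K X; (t, t') \<in> lie_cong K X \<rbrakk> \<Longrightarrow>
    (Plus s t, Plus s' t') \<in> lie_cong K X"
| cong_scale: "\<lbrakk> \<alpha> \<in> carrier K; (t, t') \<in> lie_cong K X \<rbrakk> \<Longrightarrow>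
    (Scale \<alpha> t, Scale \<alpha> t') \<in> lie_cong K X"
| cong_bracket: "\<lbrakk> (s, s') \<in> lie_cong K X; (t, t') \<in> lie_cong K X \<rbrakk> \<Longrightarrow>
    (Bracket s t, Bracket s' t') \<in> lie_cong K X"
| plus_assoc: "\<lbrakk> r \<in> lie_terms K X; s \<in> lie_terms K X; t \<in> lie_terms K X \<rbrakk> \<Longrightarrow>
    (Plus (Plus r s) t, Plus r (Plus s t)) \<in> lie_cong K X"
| plus_comm: "\<lbrakk> s \<in> lie_terms K X; t \<in> lie_terms K X \<rbrakk> \<Longrightarrow>
    (Plus s t, Plus t s) \<in> lie_cong K X"
| plus_null: "t \<in> lie_terms K X \<Longrightarrow> (Plus Null t, t) \<in> lie_cong K X"
| scale_zero: "t \<in> lie_terms K X \<Longrightarrow> (Scale \<zero> t, Null) \<in> lie_cong K X"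
| scale_one: "t \<in> lie_terms K X \<Longrightarrow> (Scale \<one> t, t) \<in> lie_cong K X"
| scale_scale: "\<lbrakk> \<alpha> \<in> carrier K; \<beta> \<in> carrier K; t \<in> lie_terms K X \<rbrakk> \<Longrightarrow>
    (Scale (\<alpha> \<otimes> \<beta>) t, Scale \<alpha> (Scale \<beta> t)) \<in> lie_cong K X"
| scale_add: "\<lbrakk> \<alpha> \<in> carrier K; \<beta> \<in> carrier K; t \<in> lie_terms K X \<rbrakk> \<Longrightarrow>
    (Scale (\<alpha> \<oplus> \<beta>) t, Plus (Scale \<alpha> t) (Scale \<beta> t)) \<in> lie_cong K X"
| scale_plus: "\<lbrakk> \<alpha> \<in> carrier K; s \<in> lie_terms K X; t \<in> lie_terms K X \<rbrakk> \<Longrightarrow>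
    (Scale \<alpha> (Plus s t), Plus (Scale \<alpha> s) (Scale \<alpha> t)) \<in> lie_cong K X"
| bracket_plus_left: "\<lbrakk> r \<in> lie_terms K X; s \<in> lie_terms K X; t \<in> lie_terms K X \<rbrakk> \<Longrightarrow>
    (Bracket (Plus r s) t, Plus (Bracket r t) (Bracket s t)) \<in> lie_cong K X"
| bracket_plus_right: "\<lbrakk> r \<in> lie_terms K X; s \<in> lie_terms K X; t \<in> lie_terms K X \<rbrakk> \<Longrightarrow>
    (Bracket r (Plus s t), Plus (Bracket r s) (Bracket r t)) \<in> lie_cong K X"
| bracket_scale_left: "\<lbrakk> \<alpha> \<in> carrier K; s \<in> lie_terms K X; t \<in> lie_terms K X \<rbrakk> \<Longrightarrow>
    (Bracket (Scale \<alpha> s) t, Scale \<alpha> (Bracket s t)) \<in> lie_cong K X"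
| bracket_scale_right: "\<lbrakk> \<alpha> \<in> carrier K; s \<in> lie_terms K X; t \<in> lie_terms K X \<rbrakk> \<Longrightarrow>
    (Bracket s (Scale \<alpha> t), Scale \<alpha> (Bracket s t)) \<in> lie_cong K X"
| bracket_self: "t \<in> lie_terms K X \<Longrightarrow> (Bracket t t, Null) \<in> lie_cong K X"
| jacobi: "\<lbrakk> r \<in> lie_terms K X; s \<in> lie_terms K X; t \<in> lie_terms K X \<rbrakk> \<Longrightarrow>
    (Plus (Plus (Bracket r (Bracket s t)) (Bracket s (Bracket t r))) (Bracket t (Bracket r s)),
      Null) \<in> lie_cong K X"

abbreviation lie_class ::
    "('a, 'k) ring_scheme \<Rightarrow> 'x set \<Rightarrow> ('a, 'x) lie_term \<Rightarrow> ('a, 'x) lie_term set"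
  where "lie_class K X t \<equiv> lie_cong K X `` {t}"

definition free_lie ::
    "('a, 'k) ring_scheme \<Rightarrow> 'x set \<Rightarrow> ('a, ('a, 'x) lie_term set) module"
  where "free_lie K X =
    \<lparr> carrier = lie_terms K X // lie_cong K X,
      mult = (\<lambda>A B. \<Union>s\<in>A. \<Union>t\<in>B. lie_class K X (Bracket s t)),
      one = undefined,
      zero = lie_class K X Null,
      add = (\<lambda>A B. \<Union>s\<in>A. \<Union>t\<in>B. lie_class K X (Plus s t)),
      smult = (\<lambda>\<alpha> A. \<Union>t\<in>A. lie_class K X (Scale \<alpha> t)) \<rparr>"

definition lie_presented ::
    "('a, 'k) ring_scheme \<Rightarrow> 'x set \<Rightarrow> ('a, 'x) lie_term set set
      \<Rightarrow> ('a, ('a, 'x) lie_term set set) module"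
  where "lie_presented K X R = lie_quot (free_lie K X) (lie_ideal K (free_lie K X) hull R)"

definition lie_presented_gen ::
    "('a, 'k) ring_scheme \<Rightarrow> 'x set \<Rightarrow> ('a, 'x) lie_term set set \<Rightarrow> 'x
      \<Rightarrow> ('a, 'x) lie_term set set"
  where "lie_presented_gen K X R x =
    (lie_ideal K (free_lie K X) hull R) +>\<^bsub>free_lie K X\<^esub> lie_class K X (Gen x)"

text \<open>The relators in \<open>F\<close> which express that \<open>g\<close> is a homomorphism from \<open>L\<close> to \<open>F\<close>.\<close>

definition lie_hom_relators ::
    "('a, 'k) ring_scheme \<Rightarrow> ('a, 'b, 'm) module_scheme \<Rightarrow> ('a, 'c, 'n) module_scheme
      \<Rightarrow> ('b \<Rightarrow> 'c) \<Rightarrow> 'c set"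
  where "lie_hom_relators K L F g =
    {g (u \<oplus>\<^bsub>L\<^esub> v) \<ominus>\<^bsub>F\<^esub> (g u \<oplus>\<^bsub>F\<^esub> g v) | u v. u \<in> carrier L \<and> v \<in> carrier L} \<union>
    {g (\<alpha> \<odot>\<^bsub>L\<^esub> u) \<ominus>\<^bsub>F\<^esub> (\<alpha> \<odot>\<^bsub>F\<^esub> g u) | \<alpha> u. \<alpha> \<in> carrier K \<and> u \<in> carrier L} \<union>
    {g (u \<otimes>\<^bsub>L\<^esub> v) \<ominus>\<^bsub>F\<^esub> (g u \<otimes>\<^bsub>F\<^esub> g v) | u v. u \<in> carrier L \<and> v \<in> carrier L}"

text \<open>
  The free product (coproduct) of \<open>C\<close> and \<open>D\<close> is generated by the disjoint union of their
  underlying sets, subject to the relations which make the two canonical maps homomorphisms.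
\<close>

definition lie_coprod_relators ::
    "('a, 'k) ring_scheme \<Rightarrow> ('a, 'b, 'm) module_scheme \<Rightarrow> ('a, 'c, 'n) module_scheme
      \<Rightarrow> ('a, 'b + 'c) lie_term set set"
  where "lie_coprod_relators K C D =
    (let X = carrier C <+> carrier D; F = free_lie K X in
      lie_hom_relators K C F (\<lambda>c. lie_class K X (Gen (Inl c))) \<union>
      lie_hom_relators K D F (\<lambda>d. lie_class K X (Gen (Inr d))))"

definition lie_coprod ::
    "('a, 'k) ring_scheme \<Rightarrow> ('a, 'b, 'm) module_scheme \<Rightarrow> ('a, 'c, 'n) module_scheme
      \<Rightarrow> ('a, ('a, 'b + 'c) lie_term set set) module"
  where "lie_coprod K C D =
    lie_presented K (carrier C <+> carrier D) (lie_coprod_relators K C D)"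

definition coprod_inl ::
    "('a, 'k) ring_scheme \<Rightarrow> ('a, 'b, 'm) module_scheme \<Rightarrow> ('a, 'c, 'n) module_scheme
      \<Rightarrow> 'b \<Rightarrow> ('a, 'b + 'c) lie_term set set"
  where "coprod_inl K C D c =
    lie_presented_gen K (carrier C <+> carrier D) (lie_coprod_relators K C D) (Inl c)"

definition coprod_inr ::
    "('a, 'k) ring_scheme \<Rightarrow> ('a, 'b, 'm) module_scheme \<Rightarrow> ('a, 'c, 'n) module_scheme
      \<Rightarrow> 'c \<Rightarrow> ('a, 'b + 'c) lie_term set set"
  where "coprod_inr K C D d =
    lie_presented_gen K (carrier C <+> carrier D) (lie_coprod_relators K C D) (Inr d)"

text \<open>
  \<open>S = C * D\<close> for subalgebras \<open>C\<close>, \<open>D\<close> of \<open>S\<close>. The homomorphism induced by the inclusions is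
  the only homomorphism from the coproduct to \<open>S\<close> satisfying the last two conditions, because
  the images of \<open>C\<close> and \<open>D\<close> generate the coproduct.
\<close>

definition is_free_product ::
    "('a, 'k) ring_scheme \<Rightarrow> ('a, 'b, 'm) module_scheme \<Rightarrow> 'b set \<Rightarrow> 'b set \<Rightarrow> bool"
  where "is_free_product K S C D \<longleftrightarrow>
    (let C' = S\<lparr>carrier := C\<rparr>; D' = S\<lparr>carrier := D\<rparr> in
      \<exists>h \<in> lie_iso K (lie_coprod K C' D') S.
        (\<forall>c\<in>C. h (coprod_inl K C' D' c) = c) \<and> (\<forall>d\<in>D. h (coprod_inr K C' D' d) = d))"


section \<open>Gradings\<close>

text \<open>\<open>C = (\<Oplus>i\<in>I. G i)\<close> as an internal direct sum, for \<open>C\<close> and the \<open>G i\<close> subspaces of \<open>L\<close>.\<close>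

definition internal_direct_sum ::
    "('b, 'm) ring_scheme \<Rightarrow> 'b set \<Rightarrow> 'i set \<Rightarrow> ('i \<Rightarrow> 'b set) \<Rightarrow> bool"
  where "internal_direct_sum L C I G \<longleftrightarrow> (\<forall>i\<in>I. G i \<subseteq> C) \<and>
    (\<forall>v\<in>C. \<exists>!f. f \<in> (\<Pi>\<^sub>E i\<in>I. G i) \<and> finite {i\<in>I. f i \<noteq> \<zero>\<^bsub>L\<^esub>} \<and>
      v = (\<Oplus>\<^bsub>L\<^esub>i\<in>{i\<in>I. f i \<noteq> \<zero>\<^bsub>L\<^esub>}. f i))"

text \<open>Gradings by positive degrees; the value of \<open>G\<close> at \<open>0\<close> is irrelevant.\<close>

definition lie_grading ::
    "('a, 'k) ring_scheme \<Rightarrow> ('a, 'b, 'm) module_scheme \<Rightarrow> (nat \<Rightarrow> 'b set) \<Rightarrow> bool"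
  where "lie_grading K L G \<longleftrightarrow>
    (\<forall>i\<ge>1. submodule (G i) K L) \<and>
    internal_direct_sum L (carrier L) {1..} G \<and>
    (\<forall>i\<ge>1. \<forall>j\<ge>1. \<forall>u\<in>G i. \<forall>v\<in>G j. u \<otimes>\<^bsub>L\<^esub> v \<in> G (i + j))"

definition graded_lie_subalgebra ::
    "('a, 'k) ring_scheme \<Rightarrow> ('a, 'b, 'm) module_scheme \<Rightarrow> (nat \<Rightarrow> 'b set) \<Rightarrow> 'b set \<Rightarrow> bool"
  where "graded_lie_subalgebra K S G C \<longleftrightarrow>
    lie_subalgebra K S C \<and> internal_direct_sum S C {1..} (\<lambda>i. C \<inter> G i)"

end

(* The coefficients of a, b, z, t are linear forms on S that vanish on [S,S]: they are read off
   from homomorphisms from L to the three-dimensional Heisenberg algebra which send x to p and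
   a, b to multiples of q, because these map S into the abelian subalgebra spanned by q and the
   centre. On the other hand, if S = C * D, then any two such forms phi, psi give a homomorphism
   from S to the Heisenberg algebra with c |-> phi(c) p on C and d |-> psi(d) q on D, so that
   [d,c] - [d',c'] in C forces psi(d) phi(c) = psi(d') phi(c').
   In degree one S is the abelian span of a and b, hence C and D cannot both have elements of
   degree one. If, say, D has none, then a and b lie in C. Write z = e + d and t = e' + d' with
   e, e' in C and d, d' in D of degree two. The relation [z,b] = [t,a] puts [d,b] - [d',a] into C,
   so that d = d' = 0. Hence C contains the generators of S, and D = 0. *)

theory Submission
  imports Defs
begin

section \<open>Lie algebras, subalgebras and ideals\<close>

text \<open>Elements of the coproduct are classes of terms, with no normal form at hand, so nothing
  in it can be shown to be non-zero by computation; every such statement must come from a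
  homomorphism out of it. The Heisenberg algebra is the smallest nilpotent target that still sees a
  bracket: it has two axes, on which characters of the two factors can be placed, and a corner which
  records products of their values. It serves twice. On the given coproduct of \<open>M\<close> and
  \<open>N\<close>, a single homomorphism yields two forms, one for \<open>a\<close> or
  \<open>b\<close> in the second coordinate and one for \<open>z\<close> or \<open>t\<close> in the
  corner. On a supposed decomposition of \<open>S\<close>, the corner turns a relation between
  brackets into an equation between scalars, where non-zero factors can be cancelled. The grading
  matters only in degrees one and two, where the generators of \<open>S\<close> live. There brackets
  contribute nothing: a bracket of two elements of \<open>S\<close> has no part of degree one, and
  its part of degree two is a bracket of combinations of \<open>a\<close> and \<open>b\<close>,
  hence zero. So these two homogeneous parts can be computed without knowing \<open>S\<close> in
  higher degrees.\<close>

lemma lie_algebraI: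
  fixes K (structure) and L :: "('a, 'b, 'm) module_scheme"
  assumes "field K"
    and add_closed: "\<And>u v. \<lbrakk> u \<in> carrier L; v \<in> carrier L \<rbrakk> \<Longrightarrow> u \<oplus>\<^bsub>L\<^esub> v \<in> carrier L"
    and zero_closed: "\<zero>\<^bsub>L\<^esub> \<in> carrier L"
    and smult_closed: "\<And>\<alpha> u. \<lbrakk> \<alpha> \<in> carrier K; u \<in> carrier L \<rbrakk> \<Longrightarrow> \<alpha> \<odot>\<^bsub>L\<^esub> u \<in> carrier L"
    and bracket_closed: "\<And>u v. \<lbrakk> u \<in> carrier L; v \<in> carrier L \<rbrakk> \<Longrightarrow> u \<otimes>\<^bsub>L\<^esub> v \<in> carrier L"
    and add_assoc: "\<And>u v w. \<lbrakk> u \<in> carrier L; v \<in> carrier L; w \<in> carrier L \<rbrakk> \<Longrightarrow>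
        (u \<oplus>\<^bsub>L\<^esub> v) \<oplus>\<^bsub>L\<^esub> w = u \<oplus>\<^bsub>L\<^esub> (v \<oplus>\<^bsub>L\<^esub> w)"
    and add_comm: "\<And>u v. \<lbrakk> u \<in> carrier L; v \<in> carrier L \<rbrakk> \<Longrightarrow> u \<oplus>\<^bsub>L\<^esub> v = v \<oplus>\<^bsub>L\<^esub> u"
    and add_zero: "\<And>u. u \<in> carrier L \<Longrightarrow> \<zero>\<^bsub>L\<^esub> \<oplus>\<^bsub>L\<^esub> u = u"
    and smult_zero: "\<And>u. u \<in> carrier L \<Longrightarrow> \<zero> \<odot>\<^bsub>L\<^esub> u = \<zero>\<^bsub>L\<^esub>"
    and smult_one: "\<And>u. u \<in> carrier L \<Longrightarrow> \<one> \<odot>\<^bsub>L\<^esub> u = u"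
    and smult_smult: "\<And>\<alpha> \<beta> u. \<lbrakk> \<alpha> \<in> carrier K; \<beta> \<in> carrier K; u \<in> carrier L \<rbrakk> \<Longrightarrow>
        (\<alpha> \<otimes> \<beta>) \<odot>\<^bsub>L\<^esub> u = \<alpha> \<odot>\<^bsub>L\<^esub> (\<beta> \<odot>\<^bsub>L\<^esub> u)"
    and smult_add_left: "\<And>\<alpha> \<beta> u. \<lbrakk> \<alpha> \<in> carrier K; \<beta> \<in> carrier K; u \<in> carrier L \<rbrakk> \<Longrightarrow>
        (\<alpha> \<oplus> \<beta>) \<odot>\<^bsub>L\<^esub> u = \<alpha> \<odot>\<^bsub>L\<^esub> u \<oplus>\<^bsub>L\<^esub> \<beta> \<odot>\<^bsub>L\<^esub> u"
    and smult_add_right: "\<And>\<alpha> u v. \<lbrakk> \<alpha> \<in> carrier K; u \<in> carrier L; v \<in> carrier L \<rbrakk> \<Longrightarrow>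
        \<alpha> \<odot>\<^bsub>L\<^esub> (u \<oplus>\<^bsub>L\<^esub> v) = \<alpha> \<odot>\<^bsub>L\<^esub> u \<oplus>\<^bsub>L\<^esub> \<alpha> \<odot>\<^bsub>L\<^esub> v"
    and bracket_add_left: "\<And>u v w. \<lbrakk> u \<in> carrier L; v \<in> carrier L; w \<in> carrier L \<rbrakk> \<Longrightarrow>
        (u \<oplus>\<^bsub>L\<^esub> v) \<otimes>\<^bsub>L\<^esub> w = u \<otimes>\<^bsub>L\<^esub> w \<oplus>\<^bsub>L\<^esub> v \<otimes>\<^bsub>L\<^esub> w"
    and bracket_add_right: "\<And>u v w. \<lbrakk> u \<in> carrier L; v \<in> carrier L; w \<in> carrier L \<rbrakk> \<Longrightarrow>
        u \<otimes>\<^bsub>L\<^esub> (v \<oplus>\<^bsub>L\<^esub> w) = u \<otimes>\<^bsub>L\<^esub> v \<oplus>\<^bsub>L\<^esub> u \<otimes>\<^bsub>L\<^esub> w"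
    and bracket_smult_left: "\<And>\<alpha> u v. \<lbrakk> \<alpha> \<in> carrier K; u \<in> carrier L; v \<in> carrier L \<rbrakk> \<Longrightarrow>
        (\<alpha> \<odot>\<^bsub>L\<^esub> u) \<otimes>\<^bsub>L\<^esub> v = \<alpha> \<odot>\<^bsub>L\<^esub> (u \<otimes>\<^bsub>L\<^esub> v)"
    and bracket_smult_right: "\<And>\<alpha> u v. \<lbrakk> \<alpha> \<in> carrier K; u \<in> carrier L; v \<in> carrier L \<rbrakk> \<Longrightarrow>
        u \<otimes>\<^bsub>L\<^esub> (\<alpha> \<odot>\<^bsub>L\<^esub> v) = \<alpha> \<odot>\<^bsub>L\<^esub> (u \<otimes>\<^bsub>L\<^esub> v)"
    and bracket_self: "\<And>u. u \<in> carrier L \<Longrightarrow> u \<otimes>\<^bsub>L\<^esub> u = \<zero>\<^bsub>L\<^esub>"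
    and jacobi: "\<And>u v w. \<lbrakk> u \<in> carrier L; v \<in> carrier L; w \<in> carrier L \<rbrakk> \<Longrightarrow>
        u \<otimes>\<^bsub>L\<^esub> (v \<otimes>\<^bsub>L\<^esub> w) \<oplus>\<^bsub>L\<^esub> v \<otimes>\<^bsub>L\<^esub> (w \<otimes>\<^bsub>L\<^esub> u) \<oplus>\<^bsub>L\<^esub> w \<otimes>\<^bsub>L\<^esub> (u \<otimes>\<^bsub>L\<^esub> v) = \<zero>\<^bsub>L\<^esub>"
  shows "lie_algebra K L"
proof -
  interpret K: field K by fact
  \<comment> \<open>The hypotheses mirror the axioms in \<open>lie_cong\<close>, which mention no
    inverses, so that they fit the term model; the multiple by -1 serves as the inverse.\<close>
  have inv: "\<exists>v\<in>carrier L. v \<oplus>\<^bsub>L\<^esub> u = \<zero>\<^bsub>L\<^esub>" if u: "u \<in> carrier L" for u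
  proof
    show "(\<ominus> \<one>) \<odot>\<^bsub>L\<^esub> u \<in> carrier L" using u by (simp add: smult_closed)
    have "(\<ominus> \<one>) \<odot>\<^bsub>L\<^esub> u \<oplus>\<^bsub>L\<^esub> u = (\<ominus> \<one>) \<odot>\<^bsub>L\<^esub> u \<oplus>\<^bsub>L\<^esub> \<one> \<odot>\<^bsub>L\<^esub> u"
      using u by (simp add: smult_one)
    also have "\<dots> = (\<ominus> \<one> \<oplus> \<one>) \<odot>\<^bsub>L\<^esub> u" using u by (simp add: smult_add_left)
    finally show "(\<ominus> \<one>) \<odot>\<^bsub>L\<^esub> u \<oplus>\<^bsub>L\<^esub> u = \<zero>\<^bsub>L\<^esub>" using u by (simp add: K.l_neg smult_zero)
  qed
  have "abelian_group L"
    by (rule abelian_groupI)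
      (use add_closed zero_closed add_assoc add_comm add_zero inv in \<open>blast+\<close>)
  then have "module K L"
    by (intro moduleI)
      (auto simp: K.is_cring smult_closed smult_add_left smult_add_right smult_smult smult_one)
  then show ?thesis
    by (intro lie_algebra.intro lie_algebra_axioms.intro \<open>field K\<close>)
      (auto simp: bracket_closed bracket_add_left bracket_add_right bracket_smult_left
        bracket_smult_right bracket_self jacobi)
qed

lemma lie_homI:
  assumes "\<And>u. u \<in> carrier L \<Longrightarrow> h u \<in> carrier L'"
    and "\<And>u v. \<lbrakk> u \<in> carrier L; v \<in> carrier L \<rbrakk> \<Longrightarrow> h (u \<oplus>\<^bsub>L\<^esub> v) = h u \<oplus>\<^bsub>L'\<^esub> h v"
    and "\<And>\<alpha> u. \<lbrakk> \<alpha> \<in> carrier K; u \<in> carrier L \<rbrakk> \<Longrightarrow> h (\<alpha> \<odot>\<^bsub>L\<^esub> u) = \<alpha> \<odot>\<^bsub>L'\<^esub> h u"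
    and "\<And>u v. \<lbrakk> u \<in> carrier L; v \<in> carrier L \<rbrakk> \<Longrightarrow> h (u \<otimes>\<^bsub>L\<^esub> v) = h u \<otimes>\<^bsub>L'\<^esub> h v"
  shows "h \<in> lie_hom K L L'"
  using assms by (auto simp: lie_hom_def)

lemma lie_homD:
  assumes "h \<in> lie_hom K L L'"
  shows "u \<in> carrier L \<Longrightarrow> h u \<in> carrier L'"
    and "\<lbrakk> u \<in> carrier L; v \<in> carrier L \<rbrakk> \<Longrightarrow> h (u \<oplus>\<^bsub>L\<^esub> v) = h u \<oplus>\<^bsub>L'\<^esub> h v"
    and "\<lbrakk> \<alpha> \<in> carrier K; u \<in> carrier L \<rbrakk> \<Longrightarrow> h (\<alpha> \<odot>\<^bsub>L\<^esub> u) = \<alpha> \<odot>\<^bsub>L'\<^esub> h u"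
    and "\<lbrakk> u \<in> carrier L; v \<in> carrier L \<rbrakk> \<Longrightarrow> h (u \<otimes>\<^bsub>L\<^esub> v) = h u \<otimes>\<^bsub>L'\<^esub> h v"
  using assms by (auto simp: lie_hom_def)

context lie_algebra
begin

text \<open>Reduces negation to scalar multiplication. Closure conditions and homomorphisms then
  need no clause for inverses, and negation in a subalgebra is seen to agree with that in
  \<open>L\<close>.\<close>

lemma minus_eq_smult: "u \<in> carrier L \<Longrightarrow> \<ominus>\<^bsub>L\<^esub> u = (\<ominus> \<one>) \<odot>\<^bsub>L\<^esub> u"
  by (simp add: smult_l_minus)

lemma zero_eq_smult: "\<zero>\<^bsub>L\<^esub> = \<zero> \<odot>\<^bsub>L\<^esub> \<zero>\<^bsub>L\<^esub>"
  by simp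

lemma bracket_zero_left [simp]: "u \<in> carrier L \<Longrightarrow> \<zero>\<^bsub>L\<^esub> \<otimes>\<^bsub>L\<^esub> u = \<zero>\<^bsub>L\<^esub>"
  using bracket_smult_left[of \<zero> "\<zero>\<^bsub>L\<^esub>" u] by (simp add: bracket_closed)

lemma bracket_zero_right [simp]: "u \<in> carrier L \<Longrightarrow> u \<otimes>\<^bsub>L\<^esub> \<zero>\<^bsub>L\<^esub> = \<zero>\<^bsub>L\<^esub>"
  using bracket_smult_right[of \<zero> u "\<zero>\<^bsub>L\<^esub>"] by (simp add: bracket_closed)

lemma bracket_anticomm:
  assumes "u \<in> carrier L" "v \<in> carrier L"
  shows "u \<otimes>\<^bsub>L\<^esub> v = \<ominus>\<^bsub>L\<^esub> (v \<otimes>\<^bsub>L\<^esub> u)"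
proof -
  have "\<zero>\<^bsub>L\<^esub> = (u \<oplus>\<^bsub>L\<^esub> v) \<otimes>\<^bsub>L\<^esub> (u \<oplus>\<^bsub>L\<^esub> v)" using assms by (simp add: bracket_self)
  also have "\<dots> = u \<otimes>\<^bsub>L\<^esub> v \<oplus>\<^bsub>L\<^esub> v \<otimes>\<^bsub>L\<^esub> u"
    using assms bracket_self[of u] bracket_self[of v]
    by (simp add: bracket_add_left bracket_add_right bracket_closed L.M.a_comm)
  finally show ?thesis using assms by (metis bracket_closed L.M.minus_equality)
qed

text \<open>By the Jacobi identity, right multiplications by commuting elements commute. This is the
  one relation between the generators of degree two that the main argument exploits.\<close>

lemma bracket_commuting:
  assumes [simp]: "a \<in> carrier L" "b \<in> carrier L" "x \<in> carrier L" and ab: "a \<otimes>\<^bsub>L\<^esub> b = \<zero>\<^bsub>L\<^esub>"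
  shows "(x \<otimes>\<^bsub>L\<^esub> a) \<otimes>\<^bsub>L\<^esub> b = (x \<otimes>\<^bsub>L\<^esub> b) \<otimes>\<^bsub>L\<^esub> a"
proof -
  define z t where "z = x \<otimes>\<^bsub>L\<^esub> a" and "t = x \<otimes>\<^bsub>L\<^esub> b"
  have [simp]: "z \<in> carrier L" "t \<in> carrier L" by (simp_all add: z_def t_def bracket_closed)
  have "a \<otimes>\<^bsub>L\<^esub> (b \<otimes>\<^bsub>L\<^esub> x) \<oplus>\<^bsub>L\<^esub> b \<otimes>\<^bsub>L\<^esub> z \<oplus>\<^bsub>L\<^esub> x \<otimes>\<^bsub>L\<^esub> (a \<otimes>\<^bsub>L\<^esub> b) = \<zero>\<^bsub>L\<^esub>"
    unfolding z_def by (rule jacobi) simp_all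
  then have "a \<otimes>\<^bsub>L\<^esub> (b \<otimes>\<^bsub>L\<^esub> x) \<oplus>\<^bsub>L\<^esub> b \<otimes>\<^bsub>L\<^esub> z = \<zero>\<^bsub>L\<^esub>"
    by (simp add: ab bracket_closed)
  moreover have "a \<otimes>\<^bsub>L\<^esub> (b \<otimes>\<^bsub>L\<^esub> x) = t \<otimes>\<^bsub>L\<^esub> a"
  proof -
    have "b \<otimes>\<^bsub>L\<^esub> x = \<ominus>\<^bsub>L\<^esub> t" unfolding t_def by (rule bracket_anticomm) simp_all
    moreover have "t \<otimes>\<^bsub>L\<^esub> a = \<ominus>\<^bsub>L\<^esub> (a \<otimes>\<^bsub>L\<^esub> t)" by (rule bracket_anticomm) simp_all
    ultimately show ?thesis by (simp add: minus_eq_smult bracket_smult_right bracket_closed)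
  qed
  ultimately have "\<ominus>\<^bsub>L\<^esub> (b \<otimes>\<^bsub>L\<^esub> z) = t \<otimes>\<^bsub>L\<^esub> a"
    by (intro L.M.minus_equality) (simp_all add: bracket_closed)
  moreover have "z \<otimes>\<^bsub>L\<^esub> b = \<ominus>\<^bsub>L\<^esub> (b \<otimes>\<^bsub>L\<^esub> z)" by (rule bracket_anticomm) simp_all
  ultimately show ?thesis by (simp only: z_def t_def)
qed

lemma lie_subalgebraI:
  assumes "H \<subseteq> carrier L" "\<zero>\<^bsub>L\<^esub> \<in> H" "\<And>u v. \<lbrakk> u \<in> H; v \<in> H \<rbrakk> \<Longrightarrow> u \<oplus>\<^bsub>L\<^esub> v \<in> H"
    "\<And>\<alpha> u. \<lbrakk> \<alpha> \<in> carrier K; u \<in> H \<rbrakk> \<Longrightarrow> \<alpha> \<odot>\<^bsub>L\<^esub> u \<in> H"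
    "\<And>u v. \<lbrakk> u \<in> H; v \<in> H \<rbrakk> \<Longrightarrow> u \<otimes>\<^bsub>L\<^esub> v \<in> H"
  shows "lie_subalgebra K L H"
  unfolding lie_subalgebra_def using assms
  by (auto intro!: submoduleI simp: minus_eq_smult subset_eq)

lemma lie_subalgebraD:
  assumes "lie_subalgebra K L H"
  shows "H \<subseteq> carrier L" "\<zero>\<^bsub>L\<^esub> \<in> H" "\<And>u v. \<lbrakk> u \<in> H; v \<in> H \<rbrakk> \<Longrightarrow> u \<oplus>\<^bsub>L\<^esub> v \<in> H"
    "\<And>\<alpha> u. \<lbrakk> \<alpha> \<in> carrier K; u \<in> H \<rbrakk> \<Longrightarrow> \<alpha> \<odot>\<^bsub>L\<^esub> u \<in> H"
    "\<And>u v. \<lbrakk> u \<in> H; v \<in> H \<rbrakk> \<Longrightarrow> u \<otimes>\<^bsub>L\<^esub> v \<in> H"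
proof -
  have H: "submodule H K L" using assms by (simp add: lie_subalgebra_def)
  show "H \<subseteq> carrier L" "\<And>u v. \<lbrakk> u \<in> H; v \<in> H \<rbrakk> \<Longrightarrow> u \<oplus>\<^bsub>L\<^esub> v \<in> H"
    "\<And>\<alpha> u. \<lbrakk> \<alpha> \<in> carrier K; u \<in> H \<rbrakk> \<Longrightarrow> \<alpha> \<odot>\<^bsub>L\<^esub> u \<in> H"
    using submoduleE[OF H] by auto
  show "\<zero>\<^bsub>L\<^esub> \<in> H" using subgroup.one_closed[OF submodule.axioms(1)[OF H]] by simp
  show "\<And>u v. \<lbrakk> u \<in> H; v \<in> H \<rbrakk> \<Longrightarrow> u \<otimes>\<^bsub>L\<^esub> v \<in> H" using assms by (simp add: lie_subalgebra_def)
qed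

lemma lie_subalgebra_carrier: "lie_subalgebra K L (carrier L)"
  by (rule lie_subalgebraI) (auto simp: bracket_closed)

text \<open>The hull is an intersection of subalgebras; the hypothesis puts the whole carrier among
  them, which keeps the intersection inside \<open>L\<close>.\<close>

lemma lie_subalgebra_hull:
  assumes "X \<subseteq> carrier L"
  shows "lie_subalgebra K L (lie_subalgebra K L hull X)"
proof (rule lie_subalgebraI)
  show "lie_subalgebra K L hull X \<subseteq> carrier L"
    using assms lie_subalgebra_carrier by (rule hull_minimal)
qed (auto simp: hull_def lie_subalgebraD)

lemma lie_algebra_subalgebra:
  assumes "lie_subalgebra K L H"
  shows "lie_algebra K (L\<lparr>carrier := H\<rparr>)"
proof -
  note H = lie_subalgebraD[OF assms]
  have [simp]: "u \<in> H \<Longrightarrow> u \<in> carrier L" for u using H(1) by auto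
  show ?thesis
    by (rule lie_algebraI)
      (auto simp: K.field_axioms H smult_l_distr smult_r_distr smult_assoc1
        bracket_add_left bracket_add_right bracket_smult_left bracket_smult_right bracket_self jacobi
        intro: L.M.a_comm L.M.a_assoc)
qed

lemma lie_subalgebra_of_subalgebra:
  assumes "lie_subalgebra K L H"
  shows "lie_subalgebra K (L\<lparr>carrier := H\<rparr>) C \<longleftrightarrow> lie_subalgebra K L C \<and> C \<subseteq> H"
proof -
  interpret H: lie_algebra K "L\<lparr>carrier := H\<rparr>" by (rule lie_algebra_subalgebra[OF assms])
  show ?thesis
  proof (intro iffI conjI)
    assume C: "lie_subalgebra K (L\<lparr>carrier := H\<rparr>) C"
    show "C \<subseteq> H" using H.lie_subalgebraD(1)[OF C] by simp
    then show "lie_subalgebra K L C"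
      using H.lie_subalgebraD[OF C] lie_subalgebraD(1)[OF assms] by (intro lie_subalgebraI) auto
  next
    assume C: "lie_subalgebra K L C \<and> C \<subseteq> H"
    then show "lie_subalgebra K (L\<lparr>carrier := H\<rparr>) C"
      using lie_subalgebraD[of C] by (intro H.lie_subalgebraI) auto
  qed
qed

lemma lie_idealI:
  assumes "I \<subseteq> carrier L" "\<zero>\<^bsub>L\<^esub> \<in> I" "\<And>u v. \<lbrakk> u \<in> I; v \<in> I \<rbrakk> \<Longrightarrow> u \<oplus>\<^bsub>L\<^esub> v \<in> I"
    "\<And>\<alpha> u. \<lbrakk> \<alpha> \<in> carrier K; u \<in> I \<rbrakk> \<Longrightarrow> \<alpha> \<odot>\<^bsub>L\<^esub> u \<in> I"
    "\<And>u v. \<lbrakk> u \<in> carrier L; v \<in> I \<rbrakk> \<Longrightarrow> u \<otimes>\<^bsub>L\<^esub> v \<in> I"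
  shows "lie_ideal K L I"
  unfolding lie_ideal_def using assms
  by (auto intro!: submoduleI simp: minus_eq_smult subset_eq)

lemma lie_idealD: "\<lbrakk> lie_ideal K L I; u \<in> carrier L; v \<in> I \<rbrakk> \<Longrightarrow> u \<otimes>\<^bsub>L\<^esub> v \<in> I"
  unfolding lie_ideal_def by blast

lemma lie_subalgebra_ideal: "lie_ideal K L I \<Longrightarrow> lie_subalgebra K L I"
  unfolding lie_ideal_def lie_subalgebra_def using submoduleE(1) by blast

text \<open>Ideals are defined by brackets on the left; anticommutativity supplies the other side,
  which is needed to multiply cosets.\<close>

lemma lie_ideal_bracket_right:
  assumes "lie_ideal K L I" "u \<in> I" "v \<in> carrier L"
  shows "u \<otimes>\<^bsub>L\<^esub> v \<in> I"
proof -
  have "u \<in> carrier L" "\<And>w. w \<in> I \<Longrightarrow> \<ominus>\<^bsub>L\<^esub> w \<in> I"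
    using assms submoduleE(1,3) unfolding lie_ideal_def by blast+
  moreover have "v \<otimes>\<^bsub>L\<^esub> u \<in> I" using assms unfolding lie_ideal_def by blast
  ultimately show ?thesis using assms(3) bracket_anticomm by metis
qed

lemma lie_ideal_hull:
  assumes "X \<subseteq> carrier L"
  shows "lie_ideal K L (lie_ideal K L hull X)"
proof (rule lie_idealI)
  have "lie_ideal K L (carrier L)" by (rule lie_idealI) (auto simp: bracket_closed)
  with assms show "lie_ideal K L hull X \<subseteq> carrier L" by (rule hull_minimal)
qed (auto simp: hull_def lie_subalgebraD[OF lie_subalgebra_ideal] lie_idealD)

lemma lie_hom_zero_minus:
  assumes "lie_algebra K H" "h \<in> lie_hom K L H"
  shows "h \<zero>\<^bsub>L\<^esub> = \<zero>\<^bsub>H\<^esub>"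
    and "u \<in> carrier L \<Longrightarrow> h (\<ominus>\<^bsub>L\<^esub> u) = \<ominus>\<^bsub>H\<^esub> h u"
    and "\<lbrakk> u \<in> carrier L; v \<in> carrier L \<rbrakk> \<Longrightarrow> h (u \<ominus>\<^bsub>L\<^esub> v) = h u \<ominus>\<^bsub>H\<^esub> h v"
proof -
  interpret H: lie_algebra K H by fact
  note h = lie_homD[OF assms(2)]
  show "h \<zero>\<^bsub>L\<^esub> = \<zero>\<^bsub>H\<^esub>"
    using h(1,3) zero_eq_smult by (metis H.smult_l_null K.zero_closed L.M.zero_closed)
  show minus: "h (\<ominus>\<^bsub>L\<^esub> u) = \<ominus>\<^bsub>H\<^esub> h u" if "u \<in> carrier L" for u
    using that by (simp add: minus_eq_smult H.minus_eq_smult h)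
  show "h (u \<ominus>\<^bsub>L\<^esub> v) = h u \<ominus>\<^bsub>H\<^esub> h v" if "u \<in> carrier L" "v \<in> carrier L" for u v
    using that by (simp add: a_minus_def h minus)
qed

lemma lie_ideal_kernel:
  assumes "lie_algebra K H" "h \<in> lie_hom K L H"
  shows "lie_ideal K L {u \<in> carrier L. h u = \<zero>\<^bsub>H\<^esub>}"
proof -
  interpret H: lie_algebra K H by fact
  show ?thesis
    by (intro lie_idealI)
      (auto simp: lie_homD[OF assms(2)] bracket_closed lie_hom_zero_minus(1)[OF assms])
qed

end

section \<open>Quotients\<close>

text \<open>Operations on cosets and on term classes are unions over all representatives. Such a
  union collapses once the result is independent of the representative.\<close>

lemma UN_eq_constI:
  assumes "a \<in> A" "\<And>x. x \<in> A \<Longrightarrow> f x = c"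
  shows "(\<Union>x\<in>A. f x) = c"
  using assms by auto

context lie_algebra
begin

lemma diff_eq_zero_iff:
  assumes "u \<in> carrier L" "v \<in> carrier L"
  shows "u \<ominus>\<^bsub>L\<^esub> v = \<zero>\<^bsub>L\<^esub> \<longleftrightarrow> u = v"
  using assms L.M.r_neg L.M.minus_equality[of u "\<ominus>\<^bsub>L\<^esub> v"] by (auto simp: a_minus_def)

lemma abelian_subgroup_lie_ideal: "lie_ideal K L I \<Longrightarrow> abelian_subgroup I L"
  unfolding lie_ideal_def
  by (intro abelian_subgroupI3 additive_subgroup.intro)
    (auto dest: submodule.axioms(1) intro: L.M.abelian_group_axioms)

lemma coset_eq_iff:
  assumes "lie_ideal K L I" "u \<in> carrier L" "v \<in> carrier L"
  shows "I +>\<^bsub>L\<^esub> u = I +>\<^bsub>L\<^esub> v \<longleftrightarrow> u \<ominus>\<^bsub>L\<^esub> v \<in> I"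
proof -
  interpret I: abelian_subgroup I L using assms(1) by (rule abelian_subgroup_lie_ideal)
  have "I +>\<^bsub>L\<^esub> u = I +>\<^bsub>L\<^esub> v \<longleftrightarrow> u \<in> I +>\<^bsub>L\<^esub> v"
    using I.a_repr_independence'[of u v] I.a_rcos_self[of u] assms(2,3) by auto
  also have "\<dots> \<longleftrightarrow> u \<oplus>\<^bsub>L\<^esub> \<ominus>\<^bsub>L\<^esub> v \<in> I"
    using I.a_rcos_module assms by simp
  finally show ?thesis by (simp add: a_minus_def)
qed

lemma coset_memD:
  assumes "lie_ideal K L I" "u \<in> carrier L" "u' \<in> I +>\<^bsub>L\<^esub> u"
  shows "u' \<in> carrier L" "u' \<ominus>\<^bsub>L\<^esub> u \<in> I"
proof -
  interpret I: abelian_subgroup I L using assms(1) by (rule abelian_subgroup_lie_ideal)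
  show "u' \<in> carrier L" using assms I.a_elemrcos_carrier by blast
  then show "u' \<ominus>\<^bsub>L\<^esub> u \<in> I"
    using I.a_rcos_module assms by (simp add: a_minus_def)
qed

lemma coset_self: "\<lbrakk> lie_ideal K L I; u \<in> carrier L \<rbrakk> \<Longrightarrow> u \<in> I +>\<^bsub>L\<^esub> u"
  using abelian_subgroup.a_rcos_self abelian_subgroup_lie_ideal by metis

lemma carrier_lie_quot: "carrier (lie_quot L I) = (\<lambda>u. I +>\<^bsub>L\<^esub> u) ` carrier L"
  by (auto simp: lie_quot_def A_RCOSETS_def')

text \<open>Writing the zero as a coset with a representative lets all operations of the quotient be
  computed on representatives alone.\<close>

lemma zero_lie_quot:
  assumes "lie_ideal K L I"
  shows "\<zero>\<^bsub>lie_quot L I\<^esub> = I +>\<^bsub>L\<^esub> \<zero>\<^bsub>L\<^esub>"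
  using L.M.a_coset_add_zero lie_subalgebraD(1)[OF lie_subalgebra_ideal[OF assms]]
  by (simp add: lie_quot_def)

lemma add_lie_quot:
  assumes "lie_ideal K L I" "u \<in> carrier L" "v \<in> carrier L"
  shows "(I +>\<^bsub>L\<^esub> u) \<oplus>\<^bsub>lie_quot L I\<^esub> (I +>\<^bsub>L\<^esub> v) = I +>\<^bsub>L\<^esub> (u \<oplus>\<^bsub>L\<^esub> v)"
  using abelian_subgroup.a_rcos_sum[OF abelian_subgroup_lie_ideal] assms
  by (simp add: lie_quot_def)

lemma smult_lie_quot:
  assumes I: "lie_ideal K L I" and "\<alpha> \<in> carrier K" "u \<in> carrier L"
  shows "\<alpha> \<odot>\<^bsub>lie_quot L I\<^esub> (I +>\<^bsub>L\<^esub> u) = I +>\<^bsub>L\<^esub> (\<alpha> \<odot>\<^bsub>L\<^esub> u)"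
proof -
  have "I +>\<^bsub>L\<^esub> (\<alpha> \<odot>\<^bsub>L\<^esub> u') = I +>\<^bsub>L\<^esub> (\<alpha> \<odot>\<^bsub>L\<^esub> u)" if "u' \<in> I +>\<^bsub>L\<^esub> u" for u'
  proof -
    note u' = coset_memD[OF I assms(3) that]
    have "\<alpha> \<odot>\<^bsub>L\<^esub> u' \<ominus>\<^bsub>L\<^esub> \<alpha> \<odot>\<^bsub>L\<^esub> u = \<alpha> \<odot>\<^bsub>L\<^esub> (u' \<ominus>\<^bsub>L\<^esub> u)"
      using assms u'(1) by (simp add: a_minus_def smult_r_distr smult_r_minus)
    then show ?thesis
      using assms u' lie_subalgebraD(4)[OF lie_subalgebra_ideal[OF I]] by (simp add: coset_eq_iff)
  qed
  then have "(\<Union>u'\<in>I +>\<^bsub>L\<^esub> u. I +>\<^bsub>L\<^esub> (\<alpha> \<odot>\<^bsub>L\<^esub> u')) = I +>\<^bsub>L\<^esub> (\<alpha> \<odot>\<^bsub>L\<^esub> u)"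
    by (rule UN_eq_constI[OF coset_self[OF I assms(3)]])
  then show ?thesis by (simp only: lie_quot_def module.simps)
qed

lemma bracket_lie_quot:
  assumes I: "lie_ideal K L I" and "u \<in> carrier L" "v \<in> carrier L"
  shows "(I +>\<^bsub>L\<^esub> u) \<otimes>\<^bsub>lie_quot L I\<^esub> (I +>\<^bsub>L\<^esub> v) = I +>\<^bsub>L\<^esub> (u \<otimes>\<^bsub>L\<^esub> v)"
proof -
  have "I +>\<^bsub>L\<^esub> (u' \<otimes>\<^bsub>L\<^esub> v') = I +>\<^bsub>L\<^esub> (u \<otimes>\<^bsub>L\<^esub> v)"
    if "u' \<in> I +>\<^bsub>L\<^esub> u" "v' \<in> I +>\<^bsub>L\<^esub> v" for u' v'
  proof -
    note u' = coset_memD[OF I assms(2) that(1)] and v' = coset_memD[OF I assms(3) that(2)]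
    have "(u' \<ominus>\<^bsub>L\<^esub> u) \<otimes>\<^bsub>L\<^esub> v' = u' \<otimes>\<^bsub>L\<^esub> v' \<ominus>\<^bsub>L\<^esub> u \<otimes>\<^bsub>L\<^esub> v'"
      "u \<otimes>\<^bsub>L\<^esub> (v' \<ominus>\<^bsub>L\<^esub> v) = u \<otimes>\<^bsub>L\<^esub> v' \<ominus>\<^bsub>L\<^esub> u \<otimes>\<^bsub>L\<^esub> v"
      using assms u'(1) v'(1)
      by (simp_all add: a_minus_def minus_eq_smult bracket_closed bracket_add_left bracket_add_right
          bracket_smult_left bracket_smult_right)
    note diff = this[symmetric]
    \<comment> \<open>The two representatives are exchanged one at a time; the first exchange uses
      the ideal property on the right, the second on the left.\<close>
    have "I +>\<^bsub>L\<^esub> (u' \<otimes>\<^bsub>L\<^esub> v') = I +>\<^bsub>L\<^esub> (u \<otimes>\<^bsub>L\<^esub> v')"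
      "I +>\<^bsub>L\<^esub> (u \<otimes>\<^bsub>L\<^esub> v') = I +>\<^bsub>L\<^esub> (u \<otimes>\<^bsub>L\<^esub> v)"
      using assms u' v' lie_ideal_bracket_right[OF I] lie_idealD[OF I]
      by (simp_all add: coset_eq_iff bracket_closed diff)
    then show ?thesis by simp
  qed
  then have "(\<Union>u'\<in>I +>\<^bsub>L\<^esub> u. \<Union>v'\<in>I +>\<^bsub>L\<^esub> v. I +>\<^bsub>L\<^esub> (u' \<otimes>\<^bsub>L\<^esub> v')) = I +>\<^bsub>L\<^esub> (u \<otimes>\<^bsub>L\<^esub> v)"
    by (intro UN_eq_constI[OF coset_self[OF I assms(2)]] UN_eq_constI[OF coset_self[OF I assms(3)]])
  then show ?thesis by (simp only: lie_quot_def rcoset_mult_def monoid.simps)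
qed

lemmas lie_quot_simps = carrier_lie_quot zero_lie_quot add_lie_quot smult_lie_quot bracket_lie_quot

lemma lie_algebra_quot:
  assumes "lie_ideal K L I"
  shows "lie_algebra K (lie_quot L I)"
proof (rule lie_algebraI)
  fix A B C assume "A \<in> carrier (lie_quot L I)" "B \<in> carrier (lie_quot L I)"
    "C \<in> carrier (lie_quot L I)"
  then show "A \<oplus>\<^bsub>lie_quot L I\<^esub> B \<oplus>\<^bsub>lie_quot L I\<^esub> C = A \<oplus>\<^bsub>lie_quot L I\<^esub> (B \<oplus>\<^bsub>lie_quot L I\<^esub> C)"
    using assms by (auto simp: lie_quot_simps L.M.a_assoc)
next
  fix A B assume "A \<in> carrier (lie_quot L I)" "B \<in> carrier (lie_quot L I)"
  then show "A \<oplus>\<^bsub>lie_quot L I\<^esub> B = B \<oplus>\<^bsub>lie_quot L I\<^esub> A"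
    using assms by (auto simp: lie_quot_simps L.M.a_comm)
qed (auto simp: lie_quot_simps assms K.field_axioms bracket_closed smult_l_distr smult_r_distr
    smult_assoc1 bracket_add_left bracket_add_right bracket_smult_left bracket_smult_right
    bracket_self jacobi)

lemma lie_hom_coset:
  assumes "lie_ideal K L I"
  shows "(\<lambda>u. I +>\<^bsub>L\<^esub> u) \<in> lie_hom K L (lie_quot L I)"
  by (rule lie_homI) (auto simp: lie_quot_simps assms)

lemma lie_quot_lift:
  assumes I: "lie_ideal K L I" and H: "lie_algebra K H" and h: "h \<in> lie_hom K L H"
    and zero: "\<And>u. u \<in> I \<Longrightarrow> h u = \<zero>\<^bsub>H\<^esub>"
  obtains h' where "h' \<in> lie_hom K (lie_quot L I) H"
    "\<And>u. u \<in> carrier L \<Longrightarrow> h' (I +>\<^bsub>L\<^esub> u) = h u"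
proof
  interpret H: lie_algebra K H by fact
  \<comment> \<open>Any representative will do, because \<open>h\<close> vanishes on
    \<open>I\<close> and is therefore constant on cosets.\<close>
  define h' where "h' = (\<lambda>A. h (SOME u. u \<in> A))"
  show h': "h' (I +>\<^bsub>L\<^esub> u) = h u" if u: "u \<in> carrier L" for u
  proof -
    define u' where "u' = (SOME u'. u' \<in> I +>\<^bsub>L\<^esub> u)"
    have "u' \<in> I +>\<^bsub>L\<^esub> u" unfolding u'_def using coset_self[OF I u] by (rule someI)
    note u' = coset_memD[OF I u this]
    have "h u' \<ominus>\<^bsub>H\<^esub> h u = h (u' \<ominus>\<^bsub>L\<^esub> u)"
      using u u' by (simp add: lie_hom_zero_minus(3)[OF H h])
    also have "\<dots> = \<zero>\<^bsub>H\<^esub>" using u' zero by simp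
    finally have "h u' = h u"
      using lie_homD(1)[OF h u] lie_homD(1)[OF h u'(1)] H.diff_eq_zero_iff by blast
    then show ?thesis by (simp add: h'_def u'_def)
  qed
  show "h' \<in> lie_hom K (lie_quot L I) H"
    by (rule lie_homI) (auto simp: lie_quot_simps I h' lie_homD[OF h] bracket_closed)
qed

end

section \<open>Free Lie algebras\<close>

lemma lie_terms_simps [simp]:
  "Gen y \<in> lie_terms K X \<longleftrightarrow> y \<in> X"
  "Null \<in> lie_terms K X"
  "Plus s t \<in> lie_terms K X \<longleftrightarrow> s \<in> lie_terms K X \<and> t \<in> lie_terms K X"
  "Scale \<alpha> t \<in> lie_terms K X \<longleftrightarrow> \<alpha> \<in> carrier K \<and> t \<in> lie_terms K X"
  "Bracket s t \<in> lie_terms K X \<longleftrightarrow> s \<in> lie_terms K X \<and> t \<in> lie_terms K X"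
  by (auto simp: lie_terms_def)

primrec lie_eval :: "('a, 'b, 'm) module_scheme \<Rightarrow> ('x \<Rightarrow> 'b) \<Rightarrow> ('a, 'x) lie_term \<Rightarrow> 'b"
  where
    "lie_eval H f (Gen y) = f y"
  | "lie_eval H f Null = \<zero>\<^bsub>H\<^esub>"
  | "lie_eval H f (Plus s t) = lie_eval H f s \<oplus>\<^bsub>H\<^esub> lie_eval H f t"
  | "lie_eval H f (Scale \<alpha> t) = \<alpha> \<odot>\<^bsub>H\<^esub> lie_eval H f t"
  | "lie_eval H f (Bracket s t) = lie_eval H f s \<otimes>\<^bsub>H\<^esub> lie_eval H f t"

lemma (in lie_algebra) lie_eval_closed:
  assumes "f \<in> X \<rightarrow> carrier L" "t \<in> lie_terms K X"
  shows "lie_eval L f t \<in> carrier L"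
  using assms(2) by (induction t) (use assms(1) in \<open>auto simp: bracket_closed\<close>)

context field
begin

lemma lie_cong_terms:
  assumes "(s, t) \<in> lie_cong R X"
  shows "s \<in> lie_terms R X \<and> t \<in> lie_terms R X"
  using assms by induction auto

lemma equiv_lie_cong: "equiv (lie_terms R X) (lie_cong R X)"
proof (rule equivI)
  show "lie_cong R X \<subseteq> lie_terms R X \<times> lie_terms R X" by (auto dest: lie_cong_terms)
  show "refl_on (lie_terms R X) (lie_cong R X)" by (auto simp: refl_on_def intro: lie_cong.refl)
  show "Relation.sym (lie_cong R X)" by (rule symI) (rule lie_cong.sym)
  show "Relation.trans (lie_cong R X)" by (rule transI) (rule lie_cong.trans)
qed

lemma lie_class_eqI: "(s, t) \<in> lie_cong R X \<Longrightarrow> lie_class R X s = lie_class R X t"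
  by (rule equiv_class_eq[OF equiv_lie_cong])

lemma lie_class_self: "t \<in> lie_terms R X \<Longrightarrow> t \<in> lie_class R X t"
  by (simp add: lie_cong.refl)

lemma carrier_free_lie: "carrier (free_lie R X) = lie_class R X ` lie_terms R X"
  by (auto simp: free_lie_def quotient_def)

lemma zero_free_lie: "\<zero>\<^bsub>free_lie R X\<^esub> = lie_class R X Null"
  by (simp add: free_lie_def)

lemma add_free_lie:
  assumes "s \<in> lie_terms R X" "t \<in> lie_terms R X"
  shows "lie_class R X s \<oplus>\<^bsub>free_lie R X\<^esub> lie_class R X t = lie_class R X (Plus s t)"
proof -
  have "(\<Union>s'\<in>lie_class R X s. \<Union>t'\<in>lie_class R X t. lie_class R X (Plus s' t')) =
      lie_class R X (Plus s t)"
    by (intro UN_eq_constI[OF lie_class_self[OF assms(1)]] UN_eq_constI[OF lie_class_self[OF assms(2)]]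
        lie_class_eqI lie_cong.cong_plus) (auto intro: lie_cong.sym)
  then show ?thesis by (simp only: free_lie_def ring.simps)
qed

lemma bracket_free_lie:
  assumes "s \<in> lie_terms R X" "t \<in> lie_terms R X"
  shows "lie_class R X s \<otimes>\<^bsub>free_lie R X\<^esub> lie_class R X t = lie_class R X (Bracket s t)"
proof -
  have "(\<Union>s'\<in>lie_class R X s. \<Union>t'\<in>lie_class R X t. lie_class R X (Bracket s' t')) =
      lie_class R X (Bracket s t)"
    by (intro UN_eq_constI[OF lie_class_self[OF assms(1)]] UN_eq_constI[OF lie_class_self[OF assms(2)]]
        lie_class_eqI lie_cong.cong_bracket) (auto intro: lie_cong.sym)
  then show ?thesis by (simp only: free_lie_def monoid.simps)
qed

lemma smult_free_lie:
  assumes "\<alpha> \<in> carrier R" "t \<in> lie_terms R X"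
  shows "\<alpha> \<odot>\<^bsub>free_lie R X\<^esub> lie_class R X t = lie_class R X (Scale \<alpha> t)"
proof -
  have "(\<Union>t'\<in>lie_class R X t. lie_class R X (Scale \<alpha> t')) = lie_class R X (Scale \<alpha> t)"
    by (intro UN_eq_constI[OF lie_class_self[OF assms(2)]] lie_class_eqI lie_cong.cong_scale assms)
      (auto intro: lie_cong.sym)
  then show ?thesis by (simp only: free_lie_def module.simps)
qed

lemmas free_lie_simps =
  carrier_free_lie zero_free_lie add_free_lie bracket_free_lie smult_free_lie

lemma lie_algebra_free_lie: "lie_algebra R (free_lie R X)"
proof (rule lie_algebraI)
  fix A B assume "A \<in> carrier (free_lie R X)" "B \<in> carrier (free_lie R X)"
  then show "A \<oplus>\<^bsub>free_lie R X\<^esub> B = B \<oplus>\<^bsub>free_lie R X\<^esub> A"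
    by (auto simp: free_lie_simps lie_cong.plus_comm[THEN lie_class_eqI] simp del: Image_singleton_iff)
next
  fix A B C assume "A \<in> carrier (free_lie R X)" "B \<in> carrier (free_lie R X)"
    "C \<in> carrier (free_lie R X)"
  then show "A \<otimes>\<^bsub>free_lie R X\<^esub> (B \<otimes>\<^bsub>free_lie R X\<^esub> C) \<oplus>\<^bsub>free_lie R X\<^esub>
      B \<otimes>\<^bsub>free_lie R X\<^esub> (C \<otimes>\<^bsub>free_lie R X\<^esub> A) \<oplus>\<^bsub>free_lie R X\<^esub>
      C \<otimes>\<^bsub>free_lie R X\<^esub> (A \<otimes>\<^bsub>free_lie R X\<^esub> B) = \<zero>\<^bsub>free_lie R X\<^esub>"
    by (auto simp: free_lie_simps lie_cong.jacobi[THEN lie_class_eqI] simp del: Image_singleton_iff)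
\<comment> \<open>The selected rules are the axioms of the congruence other than commutativity of
  addition and the Jacobi identity, which are treated above.\<close>
qed (auto simp: free_lie_simps field_axioms
    lie_cong.intros(7,9-19)[where X = X and K = R, THEN lie_class_eqI]
    simp del: Image_singleton_iff intro!: imageI)

text \<open>Soundness of the congruence: each of its axioms is an identity in \<open>H\<close>, and
  evaluation is compatible with the term constructors. Hence evaluation descends to the free Lie
  algebra.\<close>

lemma lie_eval_cong:
  assumes "lie_algebra R H" "f \<in> X \<rightarrow> carrier H" "(s, t) \<in> lie_cong R X"
  shows "lie_eval H f s = lie_eval H f t"
proof -
  interpret H: lie_algebra R H by fact
  note [simp] = H.lie_eval_closed[OF assms(2)]
  from assms(3) show ?thesis
  proof induction
    case (plus_assoc r s t)
    then show ?case by (simp add: H.M.a_assoc)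
  next
    case (plus_comm s t)
    then show ?case by (simp add: H.M.a_comm)
  qed (auto simp: H.smult_assoc1 H.smult_l_distr H.smult_r_distr H.bracket_add_left
      H.bracket_add_right H.bracket_smult_left H.bracket_smult_right H.bracket_self H.jacobi)
qed

lemma free_lie_lift:
  assumes "lie_algebra R H" "f \<in> X \<rightarrow> carrier H"
  obtains h where "h \<in> lie_hom R (free_lie R X) H" "\<And>y. y \<in> X \<Longrightarrow> h (lie_class R X (Gen y)) = f y"
proof
  interpret H: lie_algebra R H by fact
  define h where "h = (\<lambda>A. lie_eval H f (SOME t. t \<in> A))"
  have h: "h (lie_class R X t) = lie_eval H f t" if t: "t \<in> lie_terms R X" for t
  proof -
    have "(SOME t'. t' \<in> lie_class R X t) \<in> lie_class R X t"
      using lie_class_self[OF t] by (rule someI)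
    then have "(t, SOME t'. t' \<in> lie_class R X t) \<in> lie_cong R X" by simp
    from lie_eval_cong[OF assms this] show ?thesis by (simp add: h_def)
  qed
  show "h \<in> lie_hom R (free_lie R X) H"
    by (rule lie_homI)
      (auto simp del: Image_singleton_iff simp: free_lie_simps h H.lie_eval_closed[OF assms(2)])
  show "h (lie_class R X (Gen y)) = f y" if "y \<in> X" for y
    using that by (simp del: Image_singleton_iff add: h)
qed

lemma free_lie_generated:
  assumes "lie_subalgebra R (free_lie R X) H" "\<And>y. y \<in> X \<Longrightarrow> lie_class R X (Gen y) \<in> H"
  shows "carrier (free_lie R X) \<subseteq> H"
proof -
  interpret F: lie_algebra R "free_lie R X" by (rule lie_algebra_free_lie)
  note H = F.lie_subalgebraD[OF assms(1)]
  have "lie_class R X t \<in> H" if "t \<in> lie_terms R X" for t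
    using that
  proof (induction t)
    case Null
    show ?case using H(2) by (simp only: zero_free_lie)
  next
    case (Plus s t)
    then show ?case using H(3)[of "lie_class R X s" "lie_class R X t"]
      by (simp only: add_free_lie lie_terms_simps)
  next
    case (Scale \<alpha> t)
    then show ?case using H(4)[of \<alpha> "lie_class R X t"]
      by (simp only: smult_free_lie lie_terms_simps)
  next
    case (Bracket s t)
    then show ?case using H(5)[of "lie_class R X s" "lie_class R X t"]
      by (simp only: bracket_free_lie lie_terms_simps)
  qed (simp only: assms(2) lie_terms_simps)
  then show ?thesis by (auto simp: carrier_free_lie simp del: Image_singleton_iff)
qed

end

section \<open>Free products\<close>

context lie_algebra
begin

lemma lie_hom_relators_subset:
  assumes "lie_algebra K C" "g \<in> carrier C \<rightarrow> carrier L"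
  shows "lie_hom_relators K C L g \<subseteq> carrier L"
proof -
  interpret C: lie_algebra K C by fact
  have "g u \<in> carrier L" if "u \<in> carrier C" for u using assms(2) that by auto
  then show ?thesis
    by (auto simp: lie_hom_relators_def bracket_closed C.bracket_closed)
qed

lemma lie_hom_coset_relators:
  assumes "lie_algebra K C" "g \<in> carrier C \<rightarrow> carrier L"
    and I: "lie_ideal K L I" "lie_hom_relators K C L g \<subseteq> I"
  shows "(\<lambda>c. I +>\<^bsub>L\<^esub> g c) \<in> lie_hom K C (lie_quot L I)"
proof -
  interpret C: lie_algebra K C by fact
  have g: "g u \<in> carrier L" if "u \<in> carrier C" for u using assms(2) that by auto
  show ?thesis
  proof (rule lie_homI)
    fix u v assume uv: "u \<in> carrier C" "v \<in> carrier C"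
    have "g (u \<oplus>\<^bsub>C\<^esub> v) \<ominus>\<^bsub>L\<^esub> (g u \<oplus>\<^bsub>L\<^esub> g v) \<in> lie_hom_relators K C L g"
      "g (u \<otimes>\<^bsub>C\<^esub> v) \<ominus>\<^bsub>L\<^esub> (g u \<otimes>\<^bsub>L\<^esub> g v) \<in> lie_hom_relators K C L g"
      unfolding lie_hom_relators_def using uv by blast+
    note this[THEN subsetD[OF I(2)]]
    then show "I +>\<^bsub>L\<^esub> g (u \<oplus>\<^bsub>C\<^esub> v) = (I +>\<^bsub>L\<^esub> g u) \<oplus>\<^bsub>lie_quot L I\<^esub> (I +>\<^bsub>L\<^esub> g v)"
      "I +>\<^bsub>L\<^esub> g (u \<otimes>\<^bsub>C\<^esub> v) = (I +>\<^bsub>L\<^esub> g u) \<otimes>\<^bsub>lie_quot L I\<^esub> (I +>\<^bsub>L\<^esub> g v)"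
      using uv I(1) by (simp_all add: lie_quot_simps g coset_eq_iff bracket_closed C.bracket_closed)
  next
    fix \<alpha> u assume u: "\<alpha> \<in> carrier K" "u \<in> carrier C"
    have "g (\<alpha> \<odot>\<^bsub>C\<^esub> u) \<ominus>\<^bsub>L\<^esub> \<alpha> \<odot>\<^bsub>L\<^esub> g u \<in> lie_hom_relators K C L g"
      unfolding lie_hom_relators_def using u by blast
    note this[THEN subsetD[OF I(2)]]
    then show "I +>\<^bsub>L\<^esub> g (\<alpha> \<odot>\<^bsub>C\<^esub> u) = \<alpha> \<odot>\<^bsub>lie_quot L I\<^esub> (I +>\<^bsub>L\<^esub> g u)"
      using u I(1) by (simp add: lie_quot_simps g coset_eq_iff)
  qed (auto simp: carrier_lie_quot g)
qed

text \<open>A relator is a defect of \<open>g\<close> from being a homomorphism, and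
  \<open>h\<close> maps it to the same defect of the composite, which is zero.\<close>

lemma lie_hom_relators_vanish:
  assumes "lie_algebra K C" "g \<in> carrier C \<rightarrow> carrier L" "lie_algebra K H" "h \<in> lie_hom K L H"
    and "(\<lambda>c. h (g c)) \<in> lie_hom K C H" "r \<in> lie_hom_relators K C L g"
  shows "h r = \<zero>\<^bsub>H\<^esub>"
proof -
  interpret C: lie_algebra K C by fact
  interpret H: lie_algebra K H by fact
  have g: "g u \<in> carrier L" if "u \<in> carrier C" for u using assms(2) that by auto
  note h = lie_homD[OF assms(4)] and hg = lie_homD[OF assms(5)]
  show ?thesis
    using assms(6)
    by (auto simp: lie_hom_relators_def lie_hom_zero_minus(3)[OF assms(3,4)] g bracket_closed
        C.bracket_closed h(2-4) hg(2-4) H.diff_eq_zero_iff h(1) H.bracket_closed)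
qed

end

locale lie_coproduct = field K + C?: lie_algebra K C + D?: lie_algebra K D
  for K (structure) and C :: "('a, 'b, 'm) module_scheme" and D :: "('a, 'c, 'n) module_scheme"
begin

definition gens :: "('b + 'c) set"
  where "gens = Sum_Type.Plus (carrier C) (carrier D)"

definition gen :: "'b + 'c \<Rightarrow> ('a, 'b + 'c) lie_term set"
  where "gen y = lie_class K gens (Gen y)"

definition F :: "('a, ('a, 'b + 'c) lie_term set) module"
  where "F = free_lie K gens"

definition I :: "('a, 'b + 'c) lie_term set set"
  where "I = lie_ideal K F hull lie_coprod_relators K C D"

lemma coprod_eq: "lie_coprod K C D = lie_quot F I"
  and inl_eq: "coprod_inl K C D c = I +>\<^bsub>F\<^esub> gen (Inl c)"
  and inr_eq: "coprod_inr K C D d = I +>\<^bsub>F\<^esub> gen (Inr d)"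
  by (simp_all only: lie_coprod_def lie_presented_def coprod_inl_def coprod_inr_def
      lie_presented_gen_def gens_def gen_def F_def I_def)

lemma lie_algebra_F: "lie_algebra K F"
  unfolding F_def by (rule lie_algebra_free_lie)

lemma gen_closed: "y \<in> gens \<Longrightarrow> gen y \<in> carrier F"
  unfolding F_def gen_def carrier_free_lie by (intro imageI) simp

lemma gen_Inl_closed: "(\<lambda>c. gen (Inl c)) \<in> carrier C \<rightarrow> carrier F"
  and gen_Inr_closed: "(\<lambda>d. gen (Inr d)) \<in> carrier D \<rightarrow> carrier F"
  by (auto intro: gen_closed simp: gens_def)

lemma relators_eq:
  "lie_coprod_relators K C D =
    lie_hom_relators K C F (\<lambda>c. gen (Inl c)) \<union> lie_hom_relators K D F (\<lambda>d. gen (Inr d))"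
  by (simp only: lie_coprod_relators_def Let_def gen_def gens_def F_def)

lemma relators_subset: "lie_coprod_relators K C D \<subseteq> carrier F"
  unfolding relators_eq
  by (intro Un_least lie_algebra.lie_hom_relators_subset lie_algebra_F gen_Inl_closed gen_Inr_closed
      C.lie_algebra_axioms D.lie_algebra_axioms)

lemma lie_ideal_I: "lie_ideal K F I"
  unfolding I_def by (rule lie_algebra.lie_ideal_hull[OF lie_algebra_F relators_subset])

lemma relators_subset_I: "lie_coprod_relators K C D \<subseteq> I"
  unfolding I_def by (rule hull_subset)

lemma lie_algebra_coprod: "lie_algebra K (lie_coprod K C D)"
  unfolding coprod_eq by (rule lie_algebra.lie_algebra_quot[OF lie_algebra_F lie_ideal_I])

lemma lie_hom_coprod_inl: "coprod_inl K C D \<in> lie_hom K C (lie_coprod K C D)"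
  using lie_algebra.lie_hom_coset_relators[OF lie_algebra_F C.lie_algebra_axioms gen_Inl_closed
      lie_ideal_I] relators_subset_I
  unfolding coprod_eq relators_eq inl_eq[abs_def] by blast

lemma lie_hom_coprod_inr: "coprod_inr K C D \<in> lie_hom K D (lie_coprod K C D)"
  using lie_algebra.lie_hom_coset_relators[OF lie_algebra_F D.lie_algebra_axioms gen_Inr_closed
      lie_ideal_I] relators_subset_I
  unfolding coprod_eq relators_eq inr_eq[abs_def] by blast

lemma coprod_lift:
  assumes H: "lie_algebra K H" and f: "f \<in> lie_hom K C H" and g: "g \<in> lie_hom K D H"
  obtains h where "h \<in> lie_hom K (lie_coprod K C D) H"
    "\<And>c. c \<in> carrier C \<Longrightarrow> h (coprod_inl K C D c) = f c"
    "\<And>d. d \<in> carrier D \<Longrightarrow> h (coprod_inr K C D d) = g d"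
proof -
  interpret F: lie_algebra K F by (rule lie_algebra_F)
  have "case_sum f g \<in> gens \<rightarrow> carrier H"
    using lie_homD(1)[OF f] lie_homD(1)[OF g] by (auto simp: gens_def)
  then obtain h where h: "h \<in> lie_hom K F H"
    and h_gen: "\<And>y. y \<in> gens \<Longrightarrow> h (gen y) = case_sum f g y"
    unfolding gen_def F_def using free_lie_lift[OF H] by blast
  have hl: "h (gen (Inl c)) = f c" if "c \<in> carrier C" for c
    using h_gen[of "Inl c"] that by (simp add: gens_def InlI)
  have hr: "h (gen (Inr d)) = g d" if "d \<in> carrier D" for d
    using h_gen[of "Inr d"] that by (simp add: gens_def InrI)
  have "(\<lambda>c. h (gen (Inl c))) \<in> lie_hom K C H" "(\<lambda>d. h (gen (Inr d))) \<in> lie_hom K D H"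
    by (rule lie_homI; simp add: hl hr C.bracket_closed D.bracket_closed lie_homD[OF f] lie_homD[OF g])+
  then have "h r = \<zero>\<^bsub>H\<^esub>" if "r \<in> lie_coprod_relators K C D" for r
    using that F.lie_hom_relators_vanish[OF C.lie_algebra_axioms gen_Inl_closed H h]
      F.lie_hom_relators_vanish[OF D.lie_algebra_axioms gen_Inr_closed H h]
    unfolding relators_eq by blast
  then have "lie_coprod_relators K C D \<subseteq> {u \<in> carrier F. h u = \<zero>\<^bsub>H\<^esub>}"
    using relators_subset by auto
  \<comment> \<open>\<open>I\<close> is the least ideal that contains the relators, and the kernel
    of \<open>h\<close> is such an ideal.\<close>
  then have "I \<subseteq> {u \<in> carrier F. h u = \<zero>\<^bsub>H\<^esub>}"
    unfolding I_def by (rule hull_minimal) (rule F.lie_ideal_kernel[OF H h])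
  then have "\<And>u. u \<in> I \<Longrightarrow> h u = \<zero>\<^bsub>H\<^esub>" by blast
  then obtain h' where h': "h' \<in> lie_hom K (lie_quot F I) H"
    "\<And>u. u \<in> carrier F \<Longrightarrow> h' (I +>\<^bsub>F\<^esub> u) = h u"
    using F.lie_quot_lift[OF lie_ideal_I H h] by blast
  show thesis
  proof (rule that)
    show "h' \<in> lie_hom K (lie_coprod K C D) H" unfolding coprod_eq by (rule h'(1))
    show "h' (coprod_inl K C D c) = f c" if "c \<in> carrier C" for c
      unfolding inl_eq using that gen_Inl_closed by (simp add: h'(2) hl Pi_iff)
    show "h' (coprod_inr K C D d) = g d" if "d \<in> carrier D" for d
      unfolding inr_eq using that gen_Inr_closed by (simp add: h'(2) hr Pi_iff)
  qed
qed

text \<open>The preimage of \<open>P\<close> under the quotient map is a subalgebra of the free Lie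
  algebra that contains the generators, hence everything.\<close>

lemma coprod_generated:
  assumes P: "lie_subalgebra K (lie_coprod K C D) P"
    and inl: "\<And>c. c \<in> carrier C \<Longrightarrow> coprod_inl K C D c \<in> P"
    and inr: "\<And>d. d \<in> carrier D \<Longrightarrow> coprod_inr K C D d \<in> P"
  shows "P = carrier (lie_coprod K C D)"
proof -
  interpret F: lie_algebra K F by (rule lie_algebra_F)
  interpret Q: lie_algebra K "lie_coprod K C D" by (rule lie_algebra_coprod)
  define q where "q = (\<lambda>u. I +>\<^bsub>F\<^esub> u)"
  have q: "q \<in> lie_hom K F (lie_coprod K C D)"
    unfolding coprod_eq q_def by (rule F.lie_hom_coset[OF lie_ideal_I])
  have "lie_subalgebra K F {u \<in> carrier F. q u \<in> P}"
    using Q.lie_subalgebraD[OF P]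
    by (intro F.lie_subalgebraI)
      (auto simp: lie_homD[OF q] F.lie_hom_zero_minus(1)[OF lie_algebra_coprod q] F.bracket_closed)
  moreover have "gen y \<in> {u \<in> carrier F. q u \<in> P}" if "y \<in> gens" for y
    using that inl inr gen_closed[OF that] by (auto simp: q_def gens_def inl_eq inr_eq)
  ultimately have "carrier F \<subseteq> {u \<in> carrier F. q u \<in> P}"
    unfolding F_def gen_def by (rule free_lie_generated)
  moreover have "carrier (lie_coprod K C D) = q ` carrier F"
    unfolding coprod_eq q_def by (rule F.carrier_lie_quot)
  ultimately show ?thesis using Q.lie_subalgebraD(1)[OF P] by auto
qed

end

section \<open>Characters and the Heisenberg algebra\<close>

text \<open>These are the linear forms on the abelianization, that is, homomorphisms to the
  one-dimensional abelian Lie algebra, kept as scalar-valued functions so that they can serve as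
  coordinates in \<open>heis\<close>.\<close>

definition lie_character ::
    "('a, 'k) ring_scheme \<Rightarrow> ('a, 'b, 'm) module_scheme \<Rightarrow> ('b \<Rightarrow> 'a) \<Rightarrow> bool"
  where "lie_character K L \<phi> \<longleftrightarrow> \<phi> \<in> carrier L \<rightarrow> carrier K \<and>
    (\<forall>u\<in>carrier L. \<forall>v\<in>carrier L. \<phi> (u \<oplus>\<^bsub>L\<^esub> v) = \<phi> u \<oplus>\<^bsub>K\<^esub> \<phi> v) \<and>
    (\<forall>\<alpha>\<in>carrier K. \<forall>u\<in>carrier L. \<phi> (\<alpha> \<odot>\<^bsub>L\<^esub> u) = \<alpha> \<otimes>\<^bsub>K\<^esub> \<phi> u) \<and>
    (\<forall>u\<in>carrier L. \<forall>v\<in>carrier L. \<phi> (u \<otimes>\<^bsub>L\<^esub> v) = \<zero>\<^bsub>K\<^esub>)"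

lemma lie_characterD:
  assumes "lie_character K L \<phi>"
  shows "u \<in> carrier L \<Longrightarrow> \<phi> u \<in> carrier K"
    and "\<lbrakk> u \<in> carrier L; v \<in> carrier L \<rbrakk> \<Longrightarrow> \<phi> (u \<oplus>\<^bsub>L\<^esub> v) = \<phi> u \<oplus>\<^bsub>K\<^esub> \<phi> v"
    and "\<lbrakk> \<alpha> \<in> carrier K; u \<in> carrier L \<rbrakk> \<Longrightarrow> \<phi> (\<alpha> \<odot>\<^bsub>L\<^esub> u) = \<alpha> \<otimes>\<^bsub>K\<^esub> \<phi> u"
    and "\<lbrakk> u \<in> carrier L; v \<in> carrier L \<rbrakk> \<Longrightarrow> \<phi> (u \<otimes>\<^bsub>L\<^esub> v) = \<zero>\<^bsub>K\<^esub>"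
  using assms by (auto simp: lie_character_def)

lemma lie_character_subset:
  "\<lbrakk> lie_character K L \<phi>; C \<subseteq> carrier L \<rbrakk> \<Longrightarrow> lie_character K (L\<lparr>carrier := C\<rparr>) \<phi>"
  by (auto simp: lie_character_def subset_eq Pi_iff)

text \<open>The character is the coordinate at \<open>u\<^sub>0\<close>. It kills brackets because
  all brackets in \<open>L\<close> are zero.\<close>

lemma (in lie_algebra) dual_basis:
  assumes "finite_basis K L B" "u\<^sub>0 \<in> B" "lie_abelian L"
  obtains \<phi> where "lie_character K L \<phi>" "\<phi> u\<^sub>0 = \<one>" "\<And>u. u \<in> B - {u\<^sub>0} \<Longrightarrow> \<phi> u = \<zero>"
proof -
  \<comment> \<open>Coefficients are unique among functions that are extensional on
    \<open>B\<close>, which is why the candidates below are restricted to \<open>B\<close>.\<close>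
  define P where "P v c \<longleftrightarrow> c \<in> B \<rightarrow>\<^sub>E carrier K \<and> v = (\<Oplus>\<^bsub>L\<^esub>u\<in>B. c u \<odot>\<^bsub>L\<^esub> u)" for v c
  define coord where "coord v = (THE c. P v c)" for v
  have ex1: "\<exists>!c. P v c" if "v \<in> carrier L" for v
    using assms(1) that by (auto simp: finite_basis_def P_def)
  have B: "finite B" "B \<subseteq> carrier L" using assms(1) by (auto simp: finite_basis_def)
  have [simp]: "u \<in> B \<Longrightarrow> u \<in> carrier L" for u using B by auto
  have coord: "P v (coord v)" if "v \<in> carrier L" for v
    unfolding coord_def using ex1[OF that] by (rule theI')
  have coordI: "coord v = c" if "v \<in> carrier L" "P v c" for v c
    using ex1[OF that(1)] coord[OF that(1)] that(2) by blast
  have coord_closed: "coord v u \<in> carrier K" if "v \<in> carrier L" "u \<in> B" for v u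
    using coord[OF that(1)] that(2) by (auto simp: P_def)
  have coord_add: "coord (v \<oplus>\<^bsub>L\<^esub> w) = (\<lambda>u\<in>B. coord v u \<oplus> coord w u)"
    if vw: "v \<in> carrier L" "w \<in> carrier L" for v w
  proof (rule coordI)
    have "(\<Oplus>\<^bsub>L\<^esub>u\<in>B. (\<lambda>u\<in>B. coord v u \<oplus> coord w u) u \<odot>\<^bsub>L\<^esub> u) =
        (\<Oplus>\<^bsub>L\<^esub>u\<in>B. coord v u \<odot>\<^bsub>L\<^esub> u \<oplus>\<^bsub>L\<^esub> coord w u \<odot>\<^bsub>L\<^esub> u)"
      by (rule L.M.finsum_cong') (auto simp: coord_closed vw smult_l_distr)
    also have "\<dots> = (\<Oplus>\<^bsub>L\<^esub>u\<in>B. coord v u \<odot>\<^bsub>L\<^esub> u) \<oplus>\<^bsub>L\<^esub> (\<Oplus>\<^bsub>L\<^esub>u\<in>B. coord w u \<odot>\<^bsub>L\<^esub> u)"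
      by (rule L.M.finsum_addf) (auto simp: coord_closed vw)
    also have "\<dots> = v \<oplus>\<^bsub>L\<^esub> w"
      using coord[OF vw(1)] coord[OF vw(2)] by (simp add: P_def)
    finally show "P (v \<oplus>\<^bsub>L\<^esub> w) (\<lambda>u\<in>B. coord v u \<oplus> coord w u)"
      unfolding P_def using vw coord_closed by auto
  qed (use vw in simp)
  have coord_smult: "coord (\<alpha> \<odot>\<^bsub>L\<^esub> v) = (\<lambda>u\<in>B. \<alpha> \<otimes> coord v u)"
    if v: "\<alpha> \<in> carrier K" "v \<in> carrier L" for \<alpha> v
  proof (rule coordI)
    have "(\<Oplus>\<^bsub>L\<^esub>u\<in>B. (\<lambda>u\<in>B. \<alpha> \<otimes> coord v u) u \<odot>\<^bsub>L\<^esub> u) =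
        (\<Oplus>\<^bsub>L\<^esub>u\<in>B. \<alpha> \<odot>\<^bsub>L\<^esub> (coord v u \<odot>\<^bsub>L\<^esub> u))"
      by (rule L.M.finsum_cong') (auto simp: coord_closed v smult_assoc1)
    also have "\<dots> = \<alpha> \<odot>\<^bsub>L\<^esub> (\<Oplus>\<^bsub>L\<^esub>u\<in>B. coord v u \<odot>\<^bsub>L\<^esub> u)"
      using B v by (intro finsum_smult_ldistr[symmetric]) (auto simp: coord_closed)
    also have "\<dots> = \<alpha> \<odot>\<^bsub>L\<^esub> v"
      using coord[OF v(2)] by (simp add: P_def)
    finally show "P (\<alpha> \<odot>\<^bsub>L\<^esub> v) (\<lambda>u\<in>B. \<alpha> \<otimes> coord v u)"
      unfolding P_def using v coord_closed by auto
  qed (use v in simp)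
  have coord_basis: "coord u = (\<lambda>u'\<in>B. if u = u' then \<one> else \<zero>)" if u: "u \<in> B" for u
  proof (rule coordI)
    have "(\<Oplus>\<^bsub>L\<^esub>u'\<in>B. (\<lambda>u'\<in>B. if u = u' then \<one> else \<zero>) u' \<odot>\<^bsub>L\<^esub> u') =
        (\<Oplus>\<^bsub>L\<^esub>u'\<in>B. if u = u' then u' else \<zero>\<^bsub>L\<^esub>)"
      by (rule L.M.finsum_cong') auto
    also have "\<dots> = u" using B u by (intro L.M.finsum_singleton) auto
    finally show "P u (\<lambda>u'\<in>B. if u = u' then \<one> else \<zero>)"
      unfolding P_def using u by auto
  qed (use u in simp)
  have zero: "coord \<zero>\<^bsub>L\<^esub> u = \<zero>" if "u \<in> B" for u
    using fun_cong[OF coord_smult[of \<zero> "\<zero>\<^bsub>L\<^esub>"], of u] that by (simp add: coord_closed)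
  show thesis
  proof (rule that)
    show "lie_character K L (\<lambda>v. coord v u\<^sub>0)"
      using assms(2,3) by (auto simp: lie_character_def lie_abelian_def coord_closed coord_add coord_smult zero)
  qed (use assms(2) in \<open>auto simp: coord_basis\<close>)
qed

text \<open>The triple \<open>(p, q, r)\<close> stands for the strictly upper triangular matrix with entries
  \<open>p\<close>, \<open>q\<close> next to the diagonal and \<open>r\<close> in the corner.\<close>

definition heis :: "('a, 'k) ring_scheme \<Rightarrow> ('a, 'a \<times> 'a \<times> 'a) module"
  where "heis K =
    \<lparr> carrier = carrier K \<times> carrier K \<times> carrier K,
      mult = (\<lambda>(p, q, r) (p', q', r'). (\<zero>\<^bsub>K\<^esub>, \<zero>\<^bsub>K\<^esub>, p \<otimes>\<^bsub>K\<^esub> q' \<ominus>\<^bsub>K\<^esub> q \<otimes>\<^bsub>K\<^esub> p')),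
      one = undefined,
      zero = (\<zero>\<^bsub>K\<^esub>, \<zero>\<^bsub>K\<^esub>, \<zero>\<^bsub>K\<^esub>),
      add = (\<lambda>(p, q, r) (p', q', r'). (p \<oplus>\<^bsub>K\<^esub> p', q \<oplus>\<^bsub>K\<^esub> q', r \<oplus>\<^bsub>K\<^esub> r')),
      smult = (\<lambda>\<alpha> (p, q, r). (\<alpha> \<otimes>\<^bsub>K\<^esub> p, \<alpha> \<otimes>\<^bsub>K\<^esub> q, \<alpha> \<otimes>\<^bsub>K\<^esub> r)) \<rparr>"

lemma heis_simps [simp]:
  "carrier (heis K) = carrier K \<times> carrier K \<times> carrier K"
  "(p, q, r) \<otimes>\<^bsub>heis K\<^esub> (p', q', r') = (\<zero>\<^bsub>K\<^esub>, \<zero>\<^bsub>K\<^esub>, p \<otimes>\<^bsub>K\<^esub> q' \<ominus>\<^bsub>K\<^esub> q \<otimes>\<^bsub>K\<^esub> p')"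
  "\<zero>\<^bsub>heis K\<^esub> = (\<zero>\<^bsub>K\<^esub>, \<zero>\<^bsub>K\<^esub>, \<zero>\<^bsub>K\<^esub>)"
  "(p, q, r) \<oplus>\<^bsub>heis K\<^esub> (p', q', r') = (p \<oplus>\<^bsub>K\<^esub> p', q \<oplus>\<^bsub>K\<^esub> q', r \<oplus>\<^bsub>K\<^esub> r')"
  "\<alpha> \<odot>\<^bsub>heis K\<^esub> (p, q, r) = (\<alpha> \<otimes>\<^bsub>K\<^esub> p, \<alpha> \<otimes>\<^bsub>K\<^esub> q, \<alpha> \<otimes>\<^bsub>K\<^esub> r)"
  by (simp_all add: heis_def)

context field
begin

text \<open>Brackets lie in the corner and the corner is central, so every term of the Jacobi
  identity vanishes.\<close>

lemma lie_algebra_heis: "lie_algebra R (heis R)"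
proof (rule lie_algebraI)
  show "field R" by (rule field_axioms)
qed (auto simp: a_minus_def l_distr r_distr minus_add l_minus r_minus a_ac m_ac r_neg)

text \<open>Each axis is an abelian subalgebra, so placing a character on it respects brackets: both
  sides are zero.\<close>

lemma lie_hom_heis_p:
  assumes "lie_character R L \<phi>"
  shows "(\<lambda>u. (\<phi> u, \<zero>, \<zero>)) \<in> lie_hom R L (heis R)"
  by (rule lie_homI) (simp_all add: lie_characterD[OF assms] a_minus_def)

lemma lie_hom_heis_q:
  assumes "lie_character R L \<phi>"
  shows "(\<lambda>u. (\<zero>, \<phi> u, \<zero>)) \<in> lie_hom R L (heis R)"
  by (rule lie_homI) (simp_all add: lie_characterD[OF assms] a_minus_def)

text \<open>The triples with first coordinate zero form an abelian subalgebra, on which the middle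
  and the corner coordinate are both linear. The corner alone is not a character of all of
  \<open>heis\<close>.\<close>

lemma lie_character_heis:
  assumes h: "h \<in> lie_hom R L (heis R)" and p: "\<And>u. u \<in> carrier L \<Longrightarrow> fst (h u) = \<zero>"
  shows "lie_character R L (\<lambda>u. fst (snd (h u)))" "lie_character R L (\<lambda>u. snd (snd (h u)))"
proof -
  have closed: "fst (snd (h u)) \<in> carrier R" "snd (snd (h u)) \<in> carrier R" if "u \<in> carrier L" for u
    using lie_homD(1)[OF h that] by (auto simp: mem_Times_iff)
  have add: "h (u \<oplus>\<^bsub>L\<^esub> v) = (\<zero>, fst (snd (h u)) \<oplus> fst (snd (h v)), snd (snd (h u)) \<oplus> snd (snd (h v)))"
    if "u \<in> carrier L" "v \<in> carrier L" for u v
    using lie_homD(2)[OF h that] p[OF that(1)] p[OF that(2)] by (cases "h u"; cases "h v") simp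
  have smult: "h (\<alpha> \<odot>\<^bsub>L\<^esub> u) = (\<zero>, \<alpha> \<otimes> fst (snd (h u)), \<alpha> \<otimes> snd (snd (h u)))"
    if "\<alpha> \<in> carrier R" "u \<in> carrier L" for \<alpha> u
    using lie_homD(3)[OF h that] p[OF that(2)] that(1) by (cases "h u") simp
  have bracket: "h (u \<otimes>\<^bsub>L\<^esub> v) = (\<zero>, \<zero>, \<zero>)"
    if "u \<in> carrier L" "v \<in> carrier L" for u v
    using lie_homD(4)[OF h that] p[OF that(1)] p[OF that(2)] closed[OF that(1)] closed[OF that(2)]
    by (cases "h u"; cases "h v") (simp add: a_minus_def)
  show "lie_character R L (\<lambda>u. fst (snd (h u)))" "lie_character R L (\<lambda>u. snd (snd (h u)))"
    by (auto simp: lie_character_def closed add smult bracket)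
qed

end

section \<open>Consequences of a free product decomposition\<close>

text \<open>What is needed of the universal property, in a form symmetric in the two factors.\<close>

definition free_splitting ::
    "('a, 'k) ring_scheme \<Rightarrow> ('a, 'b, 'm) module_scheme \<Rightarrow> 'b set \<Rightarrow> 'b set \<Rightarrow> bool"
  where "free_splitting K S C D \<longleftrightarrow>
    lie_subalgebra K S C \<and> lie_subalgebra K S D \<and> C \<inter> D = {\<zero>\<^bsub>S\<^esub>} \<and>
    (\<forall>P. lie_subalgebra K S P \<longrightarrow> C \<subseteq> P \<longrightarrow> D \<subseteq> P \<longrightarrow> P = carrier S) \<and>
    (\<forall>f \<in> lie_hom K (S\<lparr>carrier := C\<rparr>) (heis K). \<forall>g \<in> lie_hom K (S\<lparr>carrier := D\<rparr>) (heis K).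
      \<exists>h \<in> lie_hom K S (heis K). (\<forall>c\<in>C. h c = f c) \<and> (\<forall>d\<in>D. h d = g d))"

lemma free_splitting_lift:
  assumes "free_splitting K S C D" "f \<in> lie_hom K (S\<lparr>carrier := C\<rparr>) (heis K)"
    "g \<in> lie_hom K (S\<lparr>carrier := D\<rparr>) (heis K)"
  obtains h where "h \<in> lie_hom K S (heis K)" "\<And>c. c \<in> C \<Longrightarrow> h c = f c" "\<And>d. d \<in> D \<Longrightarrow> h d = g d"
proof -
  have "\<exists>h\<in>lie_hom K S (heis K). (\<forall>c\<in>C. h c = f c) \<and> (\<forall>d\<in>D. h d = g d)"
    using assms by (simp add: free_splitting_def)
  then show thesis using that by blast
qed

text \<open>The coproduct is built on a tagged sum, so \<open>is_free_product\<close> is not visibly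
  symmetric. With this lemma it may be assumed which of the two factors has nothing in degree
  one.\<close>

lemma free_splitting_sym:
  assumes "free_splitting K S C D"
  shows "free_splitting K S D C"
  unfolding free_splitting_def
proof (intro conjI ballI)
  show "lie_subalgebra K S D" "lie_subalgebra K S C" "D \<inter> C = {\<zero>\<^bsub>S\<^esub>}"
    "\<forall>P. lie_subalgebra K S P \<longrightarrow> D \<subseteq> P \<longrightarrow> C \<subseteq> P \<longrightarrow> P = carrier S"
    using assms by (auto simp: free_splitting_def Int_commute)
next
  fix f g
  assume "f \<in> lie_hom K (S\<lparr>carrier := D\<rparr>) (heis K)" "g \<in> lie_hom K (S\<lparr>carrier := C\<rparr>) (heis K)"
  with assms obtain h where "h \<in> lie_hom K S (heis K)" "\<And>d. d \<in> D \<Longrightarrow> h d = f d" "\<And>c. c \<in> C \<Longrightarrow> h c = g c"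
    using free_splitting_lift[of K S C D g f] by metis
  then show "\<exists>h\<in>lie_hom K S (heis K). (\<forall>d\<in>D. h d = f d) \<and> (\<forall>c\<in>C. h c = g c)" by blast
qed

context lie_algebra
begin

lemma lie_iso_inverse:
  assumes j: "j \<in> lie_iso K L H"
  obtains i where "i \<in> lie_hom K H L" "\<And>u. u \<in> carrier L \<Longrightarrow> i (j u) = u"
proof
  have hom: "j \<in> lie_hom K L H" and bij: "bij_betw j (carrier L) (carrier H)"
    using j by (auto simp: lie_iso_def)
  define i where "i = inv_into (carrier L) j"
  show i_eq: "i (j u) = u" if "u \<in> carrier L" for u
    using bij that by (simp add: i_def bij_betw_def)
  have surj: "\<exists>v\<in>carrier L. u = j v" if "u \<in> carrier H" for u
    using bij that by (auto simp: bij_betw_def)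
  show "i \<in> lie_hom K H L"
  proof (rule lie_homI)
    fix u v assume "u \<in> carrier H" "v \<in> carrier H"
    then obtain u' v' where uv: "u' \<in> carrier L" "v' \<in> carrier L" "u = j u'" "v = j v'"
      using surj by metis
    then show "i (u \<oplus>\<^bsub>H\<^esub> v) = i u \<oplus>\<^bsub>L\<^esub> i v" "i (u \<otimes>\<^bsub>H\<^esub> v) = i u \<otimes>\<^bsub>L\<^esub> i v"
      using lie_homD(2,4)[OF hom uv(1,2), symmetric] by (simp_all add: i_eq bracket_closed)
  next
    fix \<alpha> u assume \<alpha>: "\<alpha> \<in> carrier K" and "u \<in> carrier H"
    then obtain u' where u: "u' \<in> carrier L" "u = j u'" using surj by metis
    then show "i (\<alpha> \<odot>\<^bsub>H\<^esub> u) = \<alpha> \<odot>\<^bsub>L\<^esub> i u"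
      using i_eq[of "\<alpha> \<odot>\<^bsub>L\<^esub> u'"] lie_homD(3)[OF hom \<alpha> u(1)] \<alpha> by (simp add: i_eq)
  next
    fix u assume "u \<in> carrier H"
    then obtain u' where "u' \<in> carrier L" "u = j u'" using surj by metis
    then show "i u \<in> carrier L" by (simp add: i_eq)
  qed
qed

text \<open>The universal property of the coproduct, transported along the inverse \<open>i\<close>
  of the given isomorphism.\<close>

lemma free_product_lift:
  assumes fp: "is_free_product K L C D" and C: "lie_subalgebra K L C" and D: "lie_subalgebra K L D"
    and H: "lie_algebra K H"
    and f: "f \<in> lie_hom K (L\<lparr>carrier := C\<rparr>) H" and g: "g \<in> lie_hom K (L\<lparr>carrier := D\<rparr>) H"
  shows "\<exists>h \<in> lie_hom K L H. (\<forall>c\<in>C. h c = f c) \<and> (\<forall>d\<in>D. h d = g d)"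
proof -
  define C' D' where "C' = L\<lparr>carrier := C\<rparr>" and "D' = L\<lparr>carrier := D\<rparr>"
  interpret cp: lie_coproduct K C' D'
    unfolding C'_def D'_def by (intro lie_coproduct.intro lie_algebra_subalgebra C D K.field_axioms)
  define Q where "Q = lie_coprod K C' D'"
  interpret Q: lie_algebra K Q unfolding Q_def by (rule cp.lie_algebra_coprod)
  have inl: "coprod_inl K C' D' c \<in> carrier Q" if "c \<in> C" for c
    using lie_homD(1)[OF cp.lie_hom_coprod_inl, of c] that by (simp add: C'_def Q_def)
  have inr: "coprod_inr K C' D' d \<in> carrier Q" if "d \<in> D" for d
    using lie_homD(1)[OF cp.lie_hom_coprod_inr, of d] that by (simp add: D'_def Q_def)
  obtain j where j: "j \<in> lie_iso K Q L"
    and jC: "\<And>c. c \<in> C \<Longrightarrow> j (coprod_inl K C' D' c) = c"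
    and jD: "\<And>d. d \<in> D \<Longrightarrow> j (coprod_inr K C' D' d) = d"
    using fp unfolding is_free_product_def Let_def C'_def D'_def Q_def by blast
  obtain k where k: "k \<in> lie_hom K Q H"
    and kC: "\<And>c. c \<in> C \<Longrightarrow> k (coprod_inl K C' D' c) = f c"
    and kD: "\<And>d. d \<in> D \<Longrightarrow> k (coprod_inr K C' D' d) = g d"
    using cp.coprod_lift[OF H, of f g] f g unfolding C'_def D'_def Q_def by auto
  obtain i where i: "i \<in> lie_hom K L Q" and ij: "\<And>u. u \<in> carrier Q \<Longrightarrow> i (j u) = u"
    using Q.lie_iso_inverse[OF j] by blast
  have "(\<lambda>u. k (i u)) \<in> lie_hom K L H"
    by (rule lie_homI) (simp_all add: lie_homD[OF i] lie_homD[OF k])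
  moreover have "\<forall>c\<in>C. k (i c) = f c"
    using ij[OF inl] by (simp add: jC kC)
  moreover have "\<forall>d\<in>D. k (i d) = g d"
    using ij[OF inr] by (simp add: jD kD)
  ultimately show ?thesis by (intro bexI[where x = "\<lambda>u. k (i u)"] conjI)
qed

text \<open>The preimage of \<open>P\<close> in the coproduct contains both canonical images, so it
  is everything, and the isomorphism is onto.\<close>

lemma free_product_generated:
  assumes fp: "is_free_product K L C D" and C: "lie_subalgebra K L C" and D: "lie_subalgebra K L D"
    and P: "lie_subalgebra K L P" "C \<subseteq> P" "D \<subseteq> P"
  shows "P = carrier L"
proof -
  let ?C = "L\<lparr>carrier := C\<rparr>" and ?D = "L\<lparr>carrier := D\<rparr>"
  interpret cp: lie_coproduct K ?C ?D
    by (intro lie_coproduct.intro lie_algebra_subalgebra C D K.field_axioms)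
  interpret Q: lie_algebra K "lie_coprod K ?C ?D" by (rule cp.lie_algebra_coprod)
  let ?Q = "lie_coprod K ?C ?D"
  obtain j where j: "j \<in> lie_hom K ?Q L" and bij: "bij_betw j (carrier ?Q) (carrier L)"
    and jC: "\<And>c. c \<in> C \<Longrightarrow> j (coprod_inl K ?C ?D c) = c"
    and jD: "\<And>d. d \<in> D \<Longrightarrow> j (coprod_inr K ?C ?D d) = d"
    using fp unfolding is_free_product_def lie_iso_def Let_def by blast
  have "lie_subalgebra K ?Q {u \<in> carrier ?Q. j u \<in> P}"
    using lie_subalgebraD[OF P(1)]
    by (intro Q.lie_subalgebraI)
      (auto simp: lie_homD[OF j] Q.lie_hom_zero_minus(1)[OF lie_algebra_axioms j] Q.bracket_closed)
  then have "carrier ?Q = {u \<in> carrier ?Q. j u \<in> P}"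
    by (rule cp.coprod_generated[symmetric])
      (use P jC jD lie_homD(1)[OF cp.lie_hom_coprod_inl] lie_homD(1)[OF cp.lie_hom_coprod_inr] in auto)
  then have "j ` carrier ?Q \<subseteq> P" by blast
  then have "carrier L \<subseteq> P" using bij by (simp add: bij_betw_def)
  then show ?thesis using lie_subalgebraD(1)[OF P(1)] by blast
qed

lemma free_splittingI:
  assumes fp: "is_free_product K L C D" and C: "lie_subalgebra K L C" and D: "lie_subalgebra K L D"
  shows "free_splitting K L C D"
proof -
  interpret C: lie_algebra K "L\<lparr>carrier := C\<rparr>" by (rule lie_algebra_subalgebra[OF C])
  \<comment> \<open>The identity on \<open>C\<close> and the zero map on \<open>D\<close> extend to
    one homomorphism into \<open>C\<close>. On a common element it takes both values, so that
    element is zero.\<close>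
  have "(\<lambda>c. c) \<in> lie_hom K (L\<lparr>carrier := C\<rparr>) (L\<lparr>carrier := C\<rparr>)"
    "(\<lambda>d. \<zero>\<^bsub>L\<^esub>) \<in> lie_hom K (L\<lparr>carrier := D\<rparr>) (L\<lparr>carrier := C\<rparr>)"
    using lie_subalgebraD[OF C] by (auto simp: lie_hom_def)
  from free_product_lift[OF fp C D C.lie_algebra_axioms this]
  have "c = \<zero>\<^bsub>L\<^esub>" if "c \<in> C" "c \<in> D" for c
    using that by auto
  then have "C \<inter> D = {\<zero>\<^bsub>L\<^esub>}" using lie_subalgebraD(2)[OF C] lie_subalgebraD(2)[OF D] by blast
  then show ?thesis
    unfolding free_splitting_def
    using C D free_product_generated[OF fp C D] free_product_lift[OF fp C D K.lie_algebra_heis] by blast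
qed

text \<open>Sending the first factor to the \<open>p\<close>-axis of the Heisenberg algebra by \<open>\<phi>\<close> and the second one
  to the \<open>q\<close>-axis by \<open>\<psi>\<close> maps \<open>C\<close> into the \<open>p\<close>-axis but \<open>d \<otimes> c\<close> to the corner \<open>- \<psi> d \<otimes> \<phi> c\<close>.\<close>

lemma free_splitting_bracket:
  assumes split: "free_splitting K L C D"
    and \<phi>: "lie_character K L \<phi>" and \<psi>: "lie_character K L \<psi>"
    and c: "c \<in> C" "c' \<in> C" and d: "d \<in> D" "d' \<in> D"
    and eq: "d \<otimes>\<^bsub>L\<^esub> c \<ominus>\<^bsub>L\<^esub> d' \<otimes>\<^bsub>L\<^esub> c' \<in> C"
  shows "\<psi> d \<otimes> \<phi> c = \<psi> d' \<otimes> \<phi> c'"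
proof -
  have sub: "C \<subseteq> carrier L" "D \<subseteq> carrier L"
    using split lie_subalgebraD(1) unfolding free_splitting_def by blast+
  have cl: "c \<in> carrier L" "c' \<in> carrier L" "d \<in> carrier L" "d' \<in> carrier L"
    using sub c d by auto
  have hom: "(\<lambda>u. (\<phi> u, \<zero>, \<zero>)) \<in> lie_hom K (L\<lparr>carrier := C\<rparr>) (heis K)"
    "(\<lambda>u. (\<zero>, \<psi> u, \<zero>)) \<in> lie_hom K (L\<lparr>carrier := D\<rparr>) (heis K)"
    using lie_character_subset[OF \<phi> sub(1)] lie_character_subset[OF \<psi> sub(2)]
    by (auto intro: K.lie_hom_heis_p K.lie_hom_heis_q)
  obtain h where h: "h \<in> lie_hom K L (heis K)"
    and hC: "\<And>c. c \<in> C \<Longrightarrow> h c = (\<phi> c, \<zero>, \<zero>)" and hD: "\<And>d. d \<in> D \<Longrightarrow> h d = (\<zero>, \<psi> d, \<zero>)"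
    using free_splitting_lift[OF split hom] by metis
  define w where "w = d \<otimes>\<^bsub>L\<^esub> c \<ominus>\<^bsub>L\<^esub> d' \<otimes>\<^bsub>L\<^esub> c'"
  have [simp]: "\<phi> c \<in> carrier K" "\<phi> c' \<in> carrier K" "\<psi> d \<in> carrier K" "\<psi> d' \<in> carrier K"
    using cl lie_characterD(1)[OF \<phi>] lie_characterD(1)[OF \<psi>] by auto
  have wC: "w \<in> C" using eq by (simp add: w_def)
  then have wl: "w \<in> carrier L" using sub by auto
  have "w \<oplus>\<^bsub>L\<^esub> d' \<otimes>\<^bsub>L\<^esub> c' = d \<otimes>\<^bsub>L\<^esub> c"
    using cl by (simp add: w_def a_minus_def bracket_closed L.M.a_assoc L.M.l_neg)
  then have "h w \<oplus>\<^bsub>heis K\<^esub> h d' \<otimes>\<^bsub>heis K\<^esub> h c' = h d \<otimes>\<^bsub>heis K\<^esub> h c"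
    using cl wl lie_homD(2,4)[OF h] bracket_closed by metis
  \<comment> \<open>Corner coordinates are compared: \<open>h w\<close> has corner zero because
    \<open>w\<close> lies in \<open>C\<close>, and a bracket of the second axis with the first
    carries a minus sign.\<close>
  then have "\<ominus> (\<psi> d' \<otimes> \<phi> c') = \<ominus> (\<psi> d \<otimes> \<phi> c)"
    using c d wC by (simp add: hC hD a_minus_def)
  then show ?thesis
    by (metis \<open>\<phi> c \<in> carrier K\<close> \<open>\<phi> c' \<in> carrier K\<close> \<open>\<psi> d \<in> carrier K\<close> \<open>\<psi> d' \<in> carrier K\<close>
        K.m_closed K.minus_minus)
qed

end

section \<open>Homogeneous components\<close>

locale graded_lie_algebra = lie_algebra +
  fixes G :: "nat \<Rightarrow> 'c set"
  assumes grading: "lie_grading K L G"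
begin

lemma submodule_G: "i \<ge> 1 \<Longrightarrow> submodule (G i) K L"
  using grading by (simp add: lie_grading_def)

lemma G_closed:
  assumes "i \<ge> 1"
  shows "u \<in> G i \<Longrightarrow> u \<in> carrier L"
    and "\<zero>\<^bsub>L\<^esub> \<in> G i"
    and "\<lbrakk> u \<in> G i; v \<in> G i \<rbrakk> \<Longrightarrow> u \<oplus>\<^bsub>L\<^esub> v \<in> G i"
    and "\<lbrakk> \<alpha> \<in> carrier K; u \<in> G i \<rbrakk> \<Longrightarrow> \<alpha> \<odot>\<^bsub>L\<^esub> u \<in> G i"
  using submoduleE[OF submodule_G[OF assms]]
    subgroup.one_closed[OF submodule.axioms(1)[OF submodule_G[OF assms]]] by auto

lemma G_bracket: "\<lbrakk> i \<ge> 1; j \<ge> 1; u \<in> G i; v \<in> G j \<rbrakk> \<Longrightarrow> u \<otimes>\<^bsub>L\<^esub> v \<in> G (i + j)"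
  using grading by (simp add: lie_grading_def)

definition decomposes :: "'c \<Rightarrow> (nat \<Rightarrow> 'c) \<Rightarrow> bool"
  where "decomposes v f \<longleftrightarrow> f \<in> (\<Pi>\<^sub>E i\<in>{1..}. G i) \<and> finite {i\<in>{1..}. f i \<noteq> \<zero>\<^bsub>L\<^esub>} \<and>
    v = (\<Oplus>\<^bsub>L\<^esub>i\<in>{i\<in>{1..}. f i \<noteq> \<zero>\<^bsub>L\<^esub>}. f i)"

text \<open>Decompositions are extensional on the positive degrees, so for \<open>v\<close> in the
  carrier the component in degree 0 is \<open>undefined\<close>; hence the condition
  \<open>i \<ge> 1\<close> in what follows.\<close>

definition component :: "nat \<Rightarrow> 'c \<Rightarrow> 'c"
  where "component i v = (THE f. decomposes v f) i"

lemma decomposes_ex1: "v \<in> carrier L \<Longrightarrow> \<exists>!f. decomposes v f"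
  using grading by (simp add: lie_grading_def internal_direct_sum_def decomposes_def)

lemma decomposes_component: "v \<in> carrier L \<Longrightarrow> decomposes v (\<lambda>i. component i v)"
  unfolding component_def using theI'[OF decomposes_ex1, of v] by simp

lemma component_eqI: "\<lbrakk> v \<in> carrier L; decomposes v f \<rbrakk> \<Longrightarrow> component i v = f i"
  using decomposes_ex1[of v] decomposes_component[of v] by (metis (no_types))

text \<open>Different vectors have different supports. Enlarging the index set brings their
  decompositions to a common one, so that they can be added termwise.\<close>

lemma finsum_support:
  assumes "f \<in> (\<Pi>\<^sub>E i\<in>{1..}. G i)" "finite A" "A \<subseteq> {1..}" "{i\<in>{1..}. f i \<noteq> \<zero>\<^bsub>L\<^esub>} \<subseteq> A"
  shows "(\<Oplus>\<^bsub>L\<^esub>i\<in>{i\<in>{1..}. f i \<noteq> \<zero>\<^bsub>L\<^esub>}. f i) = (\<Oplus>\<^bsub>L\<^esub>i\<in>A. f i)"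
proof -
  have "f i \<in> carrier L" if "i \<in> A" for i
    using assms(1,3) that G_closed(1)[of i "f i"] by (auto simp: PiE_iff)
  then show ?thesis
    by (intro L.M.add.finprod_mono_neutral_cong_left) (use assms in auto)
qed

lemma decomposesI:
  assumes "f \<in> (\<Pi>\<^sub>E i\<in>{1..}. G i)" "finite A" "A \<subseteq> {1..}" "{i\<in>{1..}. f i \<noteq> \<zero>\<^bsub>L\<^esub>} \<subseteq> A"
    "v = (\<Oplus>\<^bsub>L\<^esub>i\<in>A. f i)"
  shows "decomposes v f"
  unfolding decomposes_def using assms finsum_support[OF assms(1-4)] finite_subset by auto

lemma component_in_G: "\<lbrakk> v \<in> carrier L; i \<ge> 1 \<rbrakk> \<Longrightarrow> component i v \<in> G i"
  using decomposes_component[of v] by (auto simp: decomposes_def)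

lemma component_closed [simp]: "\<lbrakk> v \<in> carrier L; i \<ge> 1 \<rbrakk> \<Longrightarrow> component i v \<in> carrier L"
  using component_in_G G_closed(1) by blast

lemma component_homogeneous:
  assumes u: "u \<in> G i" and "i \<ge> 1" "j \<ge> 1"
  shows "component j u = (if j = i then u else \<zero>\<^bsub>L\<^esub>)"
proof -
  let ?f = "\<lambda>j\<in>{1..}. if j = i then u else \<zero>\<^bsub>L\<^esub>"
  have [simp]: "u \<in> carrier L" using u assms(2) by (rule G_closed(1)[rotated])
  have "decomposes u ?f"
    by (rule decomposesI[where A = "{i}"]) (use assms G_closed(2) in auto)
  then show ?thesis using component_eqI[of u ?f j] assms(3) by simp
qed

lemma component_add:
  assumes uv: "u \<in> carrier L" "v \<in> carrier L" and "i \<ge> 1"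
  shows "component i (u \<oplus>\<^bsub>L\<^esub> v) = component i u \<oplus>\<^bsub>L\<^esub> component i v"
proof -
  let ?f = "\<lambda>i\<in>{1..}. component i u \<oplus>\<^bsub>L\<^esub> component i v"
  note du = decomposes_component[OF uv(1), unfolded decomposes_def]
    and dv = decomposes_component[OF uv(2), unfolded decomposes_def]
  define A where "A = {i\<in>{1..}. component i u \<noteq> \<zero>\<^bsub>L\<^esub>} \<union> {i\<in>{1..}. component i v \<noteq> \<zero>\<^bsub>L\<^esub>}"
  have A: "finite A" "A \<subseteq> {1..}" using du dv by (auto simp: A_def)
  have "u = (\<Oplus>\<^bsub>L\<^esub>i\<in>A. component i u)" "v = (\<Oplus>\<^bsub>L\<^esub>i\<in>A. component i v)"
    using finsum_support[OF conjunct1[OF du] A] finsum_support[OF conjunct1[OF dv] A] du dv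
    by (auto simp: A_def)
  moreover have "(\<Oplus>\<^bsub>L\<^esub>i\<in>A. ?f i) = (\<Oplus>\<^bsub>L\<^esub>i\<in>A. component i u \<oplus>\<^bsub>L\<^esub> component i v)"
    by (rule L.M.finsum_cong') (use A uv in auto)
  moreover have "\<dots> = (\<Oplus>\<^bsub>L\<^esub>i\<in>A. component i u) \<oplus>\<^bsub>L\<^esub> (\<Oplus>\<^bsub>L\<^esub>i\<in>A. component i v)"
    by (rule L.M.finsum_addf) (use A uv in auto)
  ultimately have sum: "u \<oplus>\<^bsub>L\<^esub> v = (\<Oplus>\<^bsub>L\<^esub>i\<in>A. ?f i)" by simp
  have "?f \<in> (\<Pi>\<^sub>E i\<in>{1..}. G i)" using uv
    by (auto intro!: G_closed(3) component_in_G simp del: One_nat_def)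
  then have "decomposes (u \<oplus>\<^bsub>L\<^esub> v) ?f"
    by (rule decomposesI[OF _ A _ sum]) (use uv in \<open>auto simp: A_def\<close>)
  then show ?thesis using component_eqI[of "u \<oplus>\<^bsub>L\<^esub> v" ?f i] assms by simp
qed

lemma component_smult:
  assumes v: "\<alpha> \<in> carrier K" "v \<in> carrier L" and "i \<ge> 1"
  shows "component i (\<alpha> \<odot>\<^bsub>L\<^esub> v) = \<alpha> \<odot>\<^bsub>L\<^esub> component i v"
proof -
  let ?f = "\<lambda>i\<in>{1..}. \<alpha> \<odot>\<^bsub>L\<^esub> component i v"
  note dv = decomposes_component[OF v(2), unfolded decomposes_def]
  define A where "A = {i\<in>{1..}. component i v \<noteq> \<zero>\<^bsub>L\<^esub>}"
  have A: "finite A" "A \<subseteq> {1..}" using dv by (auto simp: A_def)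
  have "v = (\<Oplus>\<^bsub>L\<^esub>i\<in>A. component i v)" using dv by (auto simp: A_def)
  moreover have "(\<Oplus>\<^bsub>L\<^esub>i\<in>A. ?f i) = (\<Oplus>\<^bsub>L\<^esub>i\<in>A. \<alpha> \<odot>\<^bsub>L\<^esub> component i v)"
    by (rule L.M.finsum_cong') (use A v in auto)
  moreover have "\<dots> = \<alpha> \<odot>\<^bsub>L\<^esub> (\<Oplus>\<^bsub>L\<^esub>i\<in>A. component i v)"
    by (rule finsum_smult_ldistr[symmetric]) (use A v in auto)
  ultimately have sum: "\<alpha> \<odot>\<^bsub>L\<^esub> v = (\<Oplus>\<^bsub>L\<^esub>i\<in>A. ?f i)" by simp
  have "?f \<in> (\<Pi>\<^sub>E i\<in>{1..}. G i)" using v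
    by (auto intro!: G_closed(4) component_in_G simp del: One_nat_def)
  then have "decomposes (\<alpha> \<odot>\<^bsub>L\<^esub> v) ?f"
    by (rule decomposesI[OF _ A _ sum]) (use v in \<open>auto simp: A_def\<close>)
  then show ?thesis using component_eqI[of "\<alpha> \<odot>\<^bsub>L\<^esub> v" ?f i] assms by simp
qed

lemma component_zero: "i \<ge> 1 \<Longrightarrow> component i \<zero>\<^bsub>L\<^esub> = \<zero>\<^bsub>L\<^esub>"
  using component_homogeneous[of "\<zero>\<^bsub>L\<^esub>" i i] G_closed(2) by simp

lemma homogeneous_induct [consumes 1, case_names homogeneous add]:
  assumes v: "v \<in> carrier L"
    and homog: "\<And>i u. \<lbrakk> i \<ge> 1; u \<in> G i \<rbrakk> \<Longrightarrow> P u"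
    and add: "\<And>u w. \<lbrakk> u \<in> carrier L; w \<in> carrier L; P u; P w \<rbrakk> \<Longrightarrow> P (u \<oplus>\<^bsub>L\<^esub> w)"
  shows "P v"
proof -
  have "P (\<Oplus>\<^bsub>L\<^esub>i\<in>A. component i v)" if "finite A" "A \<subseteq> {1..}" for A
    using that
  proof (induction A rule: finite_induct)
    case empty
    \<comment> \<open>The empty sum needs no case of its own in the induction rule: zero is
      homogeneous of degree one.\<close>
    show ?case using homog[of 1 "\<zero>\<^bsub>L\<^esub>"] G_closed(2) by simp
  next
    case (insert i A)
    have "(\<Oplus>\<^bsub>L\<^esub>i\<in>insert i A. component i v) = component i v \<oplus>\<^bsub>L\<^esub> (\<Oplus>\<^bsub>L\<^esub>i\<in>A. component i v)"
      by (rule L.M.finsum_insert) (use insert v in auto)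
    moreover have "P (component i v)" using homog[of i] component_in_G v insert by simp
    moreover have "(\<Oplus>\<^bsub>L\<^esub>i\<in>A. component i v) \<in> carrier L"
      by (rule L.M.finsum_closed) (use insert v in auto)
    ultimately show ?case using add insert v by simp
  qed
  moreover have "v = (\<Oplus>\<^bsub>L\<^esub>i\<in>{i\<in>{1..}. component i v \<noteq> \<zero>\<^bsub>L\<^esub>}. component i v)"
    "finite {i\<in>{1..}. component i v \<noteq> \<zero>\<^bsub>L\<^esub>}"
    using decomposes_component[OF v] by (auto simp: decomposes_def)
  ultimately show ?thesis by (metis (no_types, lifting) mem_Collect_eq subsetI)
qed

text \<open>Degrees are positive, so a sum of two of them is never 1, and it is 2 only as 1 + 1. By
  additivity it suffices to check homogeneous arguments.\<close>

lemma component_bracket: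
  assumes "u \<in> carrier L" "v \<in> carrier L"
  shows "component 1 (u \<otimes>\<^bsub>L\<^esub> v) = \<zero>\<^bsub>L\<^esub>" "component 2 (u \<otimes>\<^bsub>L\<^esub> v) = component 1 u \<otimes>\<^bsub>L\<^esub> component 1 v"
proof -
  have "component 1 (u \<otimes>\<^bsub>L\<^esub> v) = \<zero>\<^bsub>L\<^esub> \<and> component 2 (u \<otimes>\<^bsub>L\<^esub> v) = component 1 u \<otimes>\<^bsub>L\<^esub> component 1 v"
    using assms
  proof (induction u rule: homogeneous_induct)
    case (homogeneous i u)
    note u = homogeneous(1,2)
    have [simp]: "u \<in> carrier L" using u by (rule G_closed(1))
    from \<open>v \<in> carrier L\<close> show ?case
    proof (induction v rule: homogeneous_induct)
      case (homogeneous j v)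
      have [simp]: "v \<in> carrier L" using homogeneous by (rule G_closed(1))
      have uv: "u \<otimes>\<^bsub>L\<^esub> v \<in> G (i + j)" using G_bracket u homogeneous by blast
      show ?case
        using u homogeneous
        by (auto simp: component_homogeneous[OF uv] component_homogeneous[OF u(2)]
            component_homogeneous[OF homogeneous(2)])
    next
      case (add v w)
      then show ?case
        by (simp add: component_add bracket_closed bracket_add_right)
    qed
  next
    case (add u w)
    then show ?case
      by (simp add: component_add bracket_closed bracket_add_left)
  qed
  then show "component 1 (u \<otimes>\<^bsub>L\<^esub> v) = \<zero>\<^bsub>L\<^esub>" "component 2 (u \<otimes>\<^bsub>L\<^esub> v) = component 1 u \<otimes>\<^bsub>L\<^esub> component 1 v"
    by auto
qed

text \<open>\<open>finsum\<close> refers to the carrier in its definition, so sums in the restricted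
  structure have to be compared with sums in \<open>L\<close>.\<close>

lemma finsum_subalgebra:
  assumes S: "lie_subalgebra K L S" and f: "f \<in> A \<rightarrow> S"
  shows "(\<Oplus>\<^bsub>L\<lparr>carrier := S\<rparr>\<^esub>i\<in>A. f i) = (\<Oplus>\<^bsub>L\<^esub>i\<in>A. f i)"
proof -
  interpret S: lie_algebra K "L\<lparr>carrier := S\<rparr>" by (rule lie_algebra_subalgebra[OF S])
  show ?thesis
    using f
  proof (induction A rule: infinite_finite_induct)
    case (insert i A)
    then have "f \<in> A \<rightarrow> S" "f i \<in> S" by auto
    moreover from this have "f \<in> A \<rightarrow> carrier L" "f i \<in> carrier L"
      using lie_subalgebraD(1)[OF S] by auto
    ultimately show ?case
      using insert S.L.M.finsum_insert[of A i f] L.M.finsum_insert[of A i f] by simp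
  qed (simp_all add: S.L.M.finsum_infinite L.M.finsum_infinite)
qed

text \<open>The decomposition of \<open>c\<close> provided by the grading of \<open>C\<close> is
  also one in \<open>L\<close>, and uniqueness there identifies the two.\<close>

lemma component_graded_subalgebra:
  assumes S: "lie_subalgebra K L S"
    and C: "graded_lie_subalgebra K (L\<lparr>carrier := S\<rparr>) (\<lambda>i. S \<inter> G i) C"
    and c: "c \<in> C" and i: "i \<ge> 1"
  shows "component i c \<in> C"
proof -
  have sub: "C \<subseteq> S" "S \<subseteq> carrier L"
    using C lie_subalgebra_of_subalgebra[OF S] lie_subalgebraD(1)[OF S]
    by (auto simp: graded_lie_subalgebra_def)
  obtain f where f: "f \<in> (\<Pi>\<^sub>E i\<in>{1..}. C \<inter> (S \<inter> G i))" "finite {i\<in>{1..}. f i \<noteq> \<zero>\<^bsub>L\<^esub>}"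
    "c = (\<Oplus>\<^bsub>L\<lparr>carrier := S\<rparr>\<^esub>i\<in>{i\<in>{1..}. f i \<noteq> \<zero>\<^bsub>L\<^esub>}. f i)"
    using C c by (auto simp: graded_lie_subalgebra_def internal_direct_sum_def)
  have "decomposes c f"
    unfolding decomposes_def
  proof (intro conjI)
    show "f \<in> (\<Pi>\<^sub>E i\<in>{1..}. G i)" using f(1) by (auto simp: PiE_iff)
    have "f \<in> {i\<in>{1..}. f i \<noteq> \<zero>\<^bsub>L\<^esub>} \<rightarrow> S" using f(1) by auto
    from finsum_subalgebra[OF S this] show "c = (\<Oplus>\<^bsub>L\<^esub>i\<in>{i\<in>{1..}. f i \<noteq> \<zero>\<^bsub>L\<^esub>}. f i)"
      using f(3) by simp
  qed (rule f(2))
  then have "component i c = f i" using component_eqI sub c by blast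
  then show ?thesis using f(1) i by auto
qed

end

section \<open>Indecomposability\<close>

context lie_algebra
begin

definition span2 :: "'c \<Rightarrow> 'c \<Rightarrow> 'c set"
  where "span2 u v = {\<alpha> \<odot>\<^bsub>L\<^esub> u \<oplus>\<^bsub>L\<^esub> \<beta> \<odot>\<^bsub>L\<^esub> v | \<alpha> \<beta>. \<alpha> \<in> carrier K \<and> \<beta> \<in> carrier K}"

lemma span2I: "\<lbrakk> \<alpha> \<in> carrier K; \<beta> \<in> carrier K; w = \<alpha> \<odot>\<^bsub>L\<^esub> u \<oplus>\<^bsub>L\<^esub> \<beta> \<odot>\<^bsub>L\<^esub> v \<rbrakk> \<Longrightarrow> w \<in> span2 u v"
  unfolding span2_def by blast

lemma span2E:
  assumes "w \<in> span2 u v"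
  obtains \<alpha> \<beta> where "\<alpha> \<in> carrier K" "\<beta> \<in> carrier K" "w = \<alpha> \<odot>\<^bsub>L\<^esub> u \<oplus>\<^bsub>L\<^esub> \<beta> \<odot>\<^bsub>L\<^esub> v"
  using assms unfolding span2_def by blast

context
  fixes u v
  assumes [simp]: "u \<in> carrier L" "v \<in> carrier L"
begin

lemma span2_left: "u \<in> span2 u v"
  by (rule span2I[of \<one> \<zero>]) simp_all

lemma span2_right: "v \<in> span2 u v"
  by (rule span2I[of \<zero> \<one>]) simp_all

lemma span2_zero: "\<zero>\<^bsub>L\<^esub> \<in> span2 u v"
  by (rule span2I[of \<zero> \<zero>]) simp_all

lemma span2_add:
  assumes "w \<in> span2 u v" "w' \<in> span2 u v"
  shows "w \<oplus>\<^bsub>L\<^esub> w' \<in> span2 u v"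
proof -
  obtain \<alpha> \<beta> \<alpha>' \<beta>' where [simp]: "\<alpha> \<in> carrier K" "\<beta> \<in> carrier K" "\<alpha>' \<in> carrier K" "\<beta>' \<in> carrier K"
    and w: "w = \<alpha> \<odot>\<^bsub>L\<^esub> u \<oplus>\<^bsub>L\<^esub> \<beta> \<odot>\<^bsub>L\<^esub> v" "w' = \<alpha>' \<odot>\<^bsub>L\<^esub> u \<oplus>\<^bsub>L\<^esub> \<beta>' \<odot>\<^bsub>L\<^esub> v"
    using assms by (elim span2E) metis
  show ?thesis
    by (rule span2I[of "\<alpha> \<oplus> \<alpha>'" "\<beta> \<oplus> \<beta>'"]) (simp_all add: w smult_l_distr L.M.a_ac)
qed

lemma span2_smult:
  assumes "\<alpha> \<in> carrier K" "w \<in> span2 u v"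
  shows "\<alpha> \<odot>\<^bsub>L\<^esub> w \<in> span2 u v"
proof -
  obtain \<beta> \<gamma> where [simp]: "\<beta> \<in> carrier K" "\<gamma> \<in> carrier K"
    and w: "w = \<beta> \<odot>\<^bsub>L\<^esub> u \<oplus>\<^bsub>L\<^esub> \<gamma> \<odot>\<^bsub>L\<^esub> v"
    using assms(2) by (rule span2E)
  show ?thesis
    by (rule span2I[of "\<alpha> \<otimes> \<beta>" "\<alpha> \<otimes> \<gamma>"]) (simp_all add: w assms(1) smult_r_distr smult_assoc1)
qed

lemma span2_bracket:
  assumes uv: "u \<otimes>\<^bsub>L\<^esub> v = \<zero>\<^bsub>L\<^esub>" and "w \<in> span2 u v" "w' \<in> span2 u v"
  shows "w \<otimes>\<^bsub>L\<^esub> w' = \<zero>\<^bsub>L\<^esub>"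
proof -
  obtain \<alpha> \<beta> \<alpha>' \<beta>' where [simp]: "\<alpha> \<in> carrier K" "\<beta> \<in> carrier K" "\<alpha>' \<in> carrier K" "\<beta>' \<in> carrier K"
    and w: "w = \<alpha> \<odot>\<^bsub>L\<^esub> u \<oplus>\<^bsub>L\<^esub> \<beta> \<odot>\<^bsub>L\<^esub> v" "w' = \<alpha>' \<odot>\<^bsub>L\<^esub> u \<oplus>\<^bsub>L\<^esub> \<beta>' \<odot>\<^bsub>L\<^esub> v"
    using assms(2,3) by (elim span2E) metis
  have "v \<otimes>\<^bsub>L\<^esub> u = \<zero>\<^bsub>L\<^esub>" using bracket_anticomm[of v u] uv by simp
  then show ?thesis
    by (simp add: w bracket_add_left bracket_add_right bracket_smult_left bracket_smult_right
        bracket_closed bracket_self uv)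
qed

end

end

text \<open>Isolates what the argument uses of the coproduct of \<open>M\<close> and
  \<open>N\<close>: a grading, two relations, and characters of \<open>S\<close> dual to the
  generators in each degree. The element \<open>x\<close> no longer occurs, so \<open>z\<close> and
  \<open>t\<close> are known only through their degree, the relation \<open>zb_ta\<close> and the
  characters.\<close>

locale indecomposable_setting = graded_lie_algebra +
  fixes a b z t S \<alpha> \<beta> \<gamma> \<delta>
  assumes a: "a \<in> G 1" and b: "b \<in> G 1" and z: "z \<in> G 2" and t: "t \<in> G 2"
    and ab: "a \<otimes>\<^bsub>L\<^esub> b = \<zero>\<^bsub>L\<^esub>" and zb_ta: "z \<otimes>\<^bsub>L\<^esub> b = t \<otimes>\<^bsub>L\<^esub> a"
    and S: "S = lie_subalgebra K L hull {a, b, z, t}"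
    and \<alpha>: "lie_character K (L\<lparr>carrier := S\<rparr>) \<alpha>" "\<alpha> a = \<one>" "\<alpha> b = \<zero>"
    and \<beta>: "lie_character K (L\<lparr>carrier := S\<rparr>) \<beta>" "\<beta> a = \<zero>" "\<beta> b = \<one>"
    and \<gamma>: "lie_character K (L\<lparr>carrier := S\<rparr>) \<gamma>" "\<gamma> z = \<one>" "\<gamma> t = \<zero>"
    and \<delta>: "lie_character K (L\<lparr>carrier := S\<rparr>) \<delta>" "\<delta> z = \<zero>" "\<delta> t = \<one>"
begin

abbreviation T where "T \<equiv> L\<lparr>carrier := S\<rparr>"

lemma gens_carrier [simp]: "a \<in> carrier L" "b \<in> carrier L" "z \<in> carrier L" "t \<in> carrier L"
  using a b z t G_closed(1)[of 1] G_closed(1)[of 2] by auto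

lemma gens_S: "a \<in> S" "b \<in> S" "z \<in> S" "t \<in> S"
  unfolding S by (auto intro: hull_inc)

lemma subalgebra_S: "lie_subalgebra K L S"
  unfolding S by (rule lie_subalgebra_hull) simp

lemma lie_algebra_T: "lie_algebra K T"
  by (rule lie_algebra_subalgebra[OF subalgebra_S])

lemma S_carrier: "s \<in> S \<Longrightarrow> s \<in> carrier L"
  using lie_subalgebraD(1)[OF subalgebra_S] by auto

text \<open>The condition is inherited by brackets, since their components in degrees one and two
  vanish: the latter is a bracket of two elements of the commutative span of \<open>a\<close> and
  \<open>b\<close>. So the two components are determined by the generators.\<close>

lemma component_S:
  assumes "s \<in> S"
  shows "component 1 s \<in> span2 a b" "component 2 s \<in> span2 z t"
proof -
  let ?P = "{s \<in> carrier L. component 1 s \<in> span2 a b \<and> component 2 s \<in> span2 z t}"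
  have "lie_subalgebra K L ?P"
  proof (rule lie_subalgebraI)
    fix u v assume "u \<in> ?P" "v \<in> ?P"
    then have uv: "u \<in> carrier L" "v \<in> carrier L" "component 1 u \<in> span2 a b" "component 1 v \<in> span2 a b"
      by blast+
    have "component 1 u \<otimes>\<^bsub>L\<^esub> component 1 v = \<zero>\<^bsub>L\<^esub>"
      by (rule span2_bracket[OF gens_carrier(1,2) ab uv(3,4)])
    then show "u \<otimes>\<^bsub>L\<^esub> v \<in> ?P"
      using uv(1,2) by (simp add: bracket_closed component_bracket span2_zero del: One_nat_def)
  qed (auto simp: component_zero component_add component_smult span2_zero span2_add span2_smult
      simp del: One_nat_def)
  moreover have "{a, b, z, t} \<subseteq> ?P"
    using a b z t by (simp add: component_homogeneous[of _ 1] component_homogeneous[of _ 2] span2_zero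
        span2_left span2_right del: One_nat_def)
  ultimately have "S \<subseteq> ?P" unfolding S by (intro hull_minimal)
  then show "component 1 s \<in> span2 a b" "component 2 s \<in> span2 z t" using assms by auto
qed

lemma character_span2:
  assumes \<phi>: "lie_character K T \<phi>" and "u \<in> S" "v \<in> S" "p \<in> carrier K" "q \<in> carrier K"
  shows "\<phi> (p \<odot>\<^bsub>L\<^esub> u \<oplus>\<^bsub>L\<^esub> q \<odot>\<^bsub>L\<^esub> v) = p \<otimes> \<phi> u \<oplus> q \<otimes> \<phi> v"
  using lie_characterD(2,3)[OF \<phi>] assms(2-) lie_subalgebraD(4)[OF subalgebra_S] by simp

text \<open>\<open>\<alpha>\<close> and \<open>\<beta>\<close> are dual to \<open>a\<close> and
  \<open>b\<close> and so give the coefficients. Hence characters detect every non-zero element of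
  degree one; \<open>degree2\<close> does the same one degree higher.\<close>

lemma degree1:
  assumes "s \<in> S" "s \<in> G 1"
  shows "s = \<alpha> s \<odot>\<^bsub>L\<^esub> a \<oplus>\<^bsub>L\<^esub> \<beta> s \<odot>\<^bsub>L\<^esub> b"
proof -
  have "s \<in> span2 a b" using component_S(1)[OF assms(1)] assms(2) by (simp add: component_homogeneous)
  then obtain p q where pq: "p \<in> carrier K" "q \<in> carrier K" "s = p \<odot>\<^bsub>L\<^esub> a \<oplus>\<^bsub>L\<^esub> q \<odot>\<^bsub>L\<^esub> b"
    by (rule span2E)
  have "\<alpha> s = p" "\<beta> s = q"
    unfolding pq(3) using pq(1,2) by (simp_all add: character_span2 gens_S \<alpha> \<beta>)
  then show ?thesis using pq(3) by simp
qed

lemma degree2: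
  assumes "s \<in> S" "s \<in> G 2"
  shows "s = \<gamma> s \<odot>\<^bsub>L\<^esub> z \<oplus>\<^bsub>L\<^esub> \<delta> s \<odot>\<^bsub>L\<^esub> t"
proof -
  have "s \<in> span2 z t" using component_S(2)[OF assms(1)] assms(2) by (simp add: component_homogeneous)
  then obtain p q where pq: "p \<in> carrier K" "q \<in> carrier K" "s = p \<odot>\<^bsub>L\<^esub> z \<oplus>\<^bsub>L\<^esub> q \<odot>\<^bsub>L\<^esub> t"
    by (rule span2E)
  have "\<gamma> s = p" "\<delta> s = q"
    unfolding pq(3) using pq(1,2) by (simp_all add: character_span2 gens_S \<gamma> \<delta>)
  then show ?thesis using pq(3) by simp
qed

section \<open>Graded free decompositions of \<open>S\<close>\<close>

context
  fixes C D
  assumes C: "graded_lie_subalgebra K T (\<lambda>i. S \<inter> G i) C"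
    and D: "graded_lie_subalgebra K T (\<lambda>i. S \<inter> G i) D"
    and split: "free_splitting K T C D"
begin

lemma CD_subalgebras: "lie_subalgebra K L C" "C \<subseteq> S" "lie_subalgebra K L D" "D \<subseteq> S"
  using C D lie_subalgebra_of_subalgebra[OF subalgebra_S] by (auto simp: graded_lie_subalgebra_def)

text \<open>The elements of \<open>S\<close> whose components of degrees one and two split form a
  subalgebra that contains \<open>C\<close> and \<open>D\<close>, hence all of \<open>S\<close>.
  Gradedness of the factors is what puts \<open>C\<close> and \<open>D\<close> into it.\<close>

lemma component_split:
  assumes "s \<in> S" "i = 1 \<or> i = 2"
  shows "\<exists>c\<in>C \<inter> G i. \<exists>d\<in>D \<inter> G i. component i s = c \<oplus>\<^bsub>L\<^esub> d"
proof -
  interpret T: lie_algebra K T by (rule lie_algebra_T)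
  note C_sub = lie_subalgebraD[OF CD_subalgebras(1)] and D_sub = lie_subalgebraD[OF CD_subalgebras(3)]
  define Q where "Q i = {c \<oplus>\<^bsub>L\<^esub> d | c d. c \<in> C \<inter> G i \<and> d \<in> D \<inter> G i}" for i
  have QI: "w \<in> Q i" if "c \<in> C" "c \<in> G i" "d \<in> D" "d \<in> G i" "w = c \<oplus>\<^bsub>L\<^esub> d" for i w c d
    unfolding Q_def using that by blast
  have QE: "\<exists>c d. c \<in> C \<and> c \<in> G i \<and> d \<in> D \<and> d \<in> G i \<and> w = c \<oplus>\<^bsub>L\<^esub> d" if "w \<in> Q i" for i w
    using that unfolding Q_def by blast
  have zero: "\<zero>\<^bsub>L\<^esub> \<in> Q i" if "i \<ge> 1" for i
    by (rule QI[of "\<zero>\<^bsub>L\<^esub>" _ "\<zero>\<^bsub>L\<^esub>"]) (use that C_sub(2) D_sub(2) G_closed(2) in auto)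
  have add: "w \<oplus>\<^bsub>L\<^esub> w' \<in> Q i" if i: "i \<ge> 1" and w: "w \<in> Q i" "w' \<in> Q i" for i w w'
  proof -
    obtain c d c' d' where *: "c \<in> C" "c \<in> G i" "d \<in> D" "d \<in> G i" "w = c \<oplus>\<^bsub>L\<^esub> d"
      "c' \<in> C" "c' \<in> G i" "d' \<in> D" "d' \<in> G i" "w' = c' \<oplus>\<^bsub>L\<^esub> d'"
      using QE[OF w(1)] QE[OF w(2)] by blast
    have "w \<oplus>\<^bsub>L\<^esub> w' = (c \<oplus>\<^bsub>L\<^esub> c') \<oplus>\<^bsub>L\<^esub> (d \<oplus>\<^bsub>L\<^esub> d')"
      using * G_closed(1)[OF i] by (simp add: L.M.a_ac)
    then show ?thesis
      using * C_sub(3) D_sub(3) G_closed(3)[OF i] by (intro QI[of "c \<oplus>\<^bsub>L\<^esub> c'" _ "d \<oplus>\<^bsub>L\<^esub> d'"]) auto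
  qed
  have smult: "\<kappa> \<odot>\<^bsub>L\<^esub> w \<in> Q i" if i: "i \<ge> 1" and \<kappa>: "\<kappa> \<in> carrier K" and w: "w \<in> Q i" for i \<kappa> w
  proof -
    obtain c d where *: "c \<in> C" "c \<in> G i" "d \<in> D" "d \<in> G i" "w = c \<oplus>\<^bsub>L\<^esub> d"
      using QE[OF w] by blast
    have "\<kappa> \<odot>\<^bsub>L\<^esub> w = \<kappa> \<odot>\<^bsub>L\<^esub> c \<oplus>\<^bsub>L\<^esub> \<kappa> \<odot>\<^bsub>L\<^esub> d"
      using * \<kappa> G_closed(1)[OF i] by (simp add: smult_r_distr)
    then show ?thesis
      using * \<kappa> C_sub(4) D_sub(4) G_closed(4)[OF i]
      by (intro QI[of "\<kappa> \<odot>\<^bsub>L\<^esub> c" _ "\<kappa> \<odot>\<^bsub>L\<^esub> d"]) auto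
  qed
  let ?P = "{s \<in> S. component 1 s \<in> Q 1 \<and> component 2 s \<in> Q 2}"
  have "lie_subalgebra K T ?P"
  proof (rule T.lie_subalgebraI)
    fix u v assume "u \<in> ?P" "v \<in> ?P"
    then have uv: "u \<in> S" "v \<in> S" by auto
    \<comment> \<open>With this both low components of the bracket are zero, and zero splits
      trivially.\<close>
    then have "component 1 u \<otimes>\<^bsub>L\<^esub> component 1 v = \<zero>\<^bsub>L\<^esub>"
      by (intro span2_bracket[OF gens_carrier(1,2) ab] component_S(1))
    then show "u \<otimes>\<^bsub>T\<^esub> v \<in> ?P"
      using uv S_carrier lie_subalgebraD(5)[OF subalgebra_S] zero
      by (simp add: component_bracket del: One_nat_def)
  qed (use S_carrier lie_subalgebraD[OF subalgebra_S] zero add smult in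
      \<open>auto simp: component_zero component_add component_smult simp del: One_nat_def\<close>)
  moreover have "C \<subseteq> ?P"
  proof
    fix c assume c: "c \<in> C"
    have "component i c \<in> Q i" if "i \<ge> 1" for i
      using c that component_graded_subalgebra[OF subalgebra_S C c that] component_in_G[OF _ that]
        C_sub(1) D_sub(2) G_closed(2)[OF that]
      by (intro QI[of "component i c" _ "\<zero>\<^bsub>L\<^esub>"]) auto
    then show "c \<in> ?P" using c CD_subalgebras(2) by auto
  qed
  moreover have "D \<subseteq> ?P"
  proof
    fix d assume d: "d \<in> D"
    have "component i d \<in> Q i" if "i \<ge> 1" for i
      using d that component_graded_subalgebra[OF subalgebra_S D d that] component_in_G[OF _ that]
        D_sub(1) C_sub(2) G_closed(2)[OF that]
      by (intro QI[of "\<zero>\<^bsub>L\<^esub>" _ "component i d"]) auto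
    then show "d \<in> ?P" using d CD_subalgebras(4) by auto
  qed
  ultimately have "?P = S" using split by (simp add: free_splitting_def)
  then have "component i s \<in> Q i" using assms by blast
  then show ?thesis unfolding Q_def by blast
qed

text \<open>Transfers \<open>free_splitting_bracket\<close> from \<open>S\<close> to the operations
  of \<open>L\<close>. Only negation is defined through the carrier, and in both structures it is
  the multiple by -1.\<close>

lemma bracket_factors:
  assumes "lie_character K T \<phi>" "lie_character K T \<psi>" "c \<in> C" "c' \<in> C" "d \<in> D" "d' \<in> D"
    and "d \<otimes>\<^bsub>L\<^esub> c \<ominus>\<^bsub>L\<^esub> d' \<otimes>\<^bsub>L\<^esub> c' \<in> C"
  shows "\<psi> d \<otimes> \<phi> c = \<psi> d' \<otimes> \<phi> c'"
proof -
  interpret T: lie_algebra K T by (rule lie_algebra_T)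
  have "d' \<otimes>\<^bsub>L\<^esub> c' \<in> S"
    using assms CD_subalgebras lie_subalgebraD(5)[OF subalgebra_S] by blast
  then have "\<ominus>\<^bsub>T\<^esub> (d' \<otimes>\<^bsub>L\<^esub> c') = \<ominus>\<^bsub>L\<^esub> (d' \<otimes>\<^bsub>L\<^esub> c')"
    using T.minus_eq_smult[of "d' \<otimes>\<^bsub>L\<^esub> c'"] minus_eq_smult[of "d' \<otimes>\<^bsub>L\<^esub> c'"] S_carrier by simp
  then show ?thesis
    using T.free_splitting_bracket[OF split assms(1-6)] assms(7) by (simp add: a_minus_def)
qed

text \<open>Elements of degree one commute, so \<open>d \<otimes> c\<close> is zero and lies in
  \<open>C\<close>. If both were non-zero, characters detecting them would have values whose product
  is zero in a field.\<close>

lemma degree1_factor_trivial: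
  assumes "c \<in> C" "c \<in> G 1" "c \<noteq> \<zero>\<^bsub>L\<^esub>" "d \<in> D" "d \<in> G 1"
  shows "d = \<zero>\<^bsub>L\<^esub>"
proof (rule ccontr)
  assume "d \<noteq> \<zero>\<^bsub>L\<^esub>"
  have S: "c \<in> S" "d \<in> S" using assms CD_subalgebras by auto
  have ex: "\<exists>\<phi>. lie_character K T \<phi> \<and> \<phi> s \<noteq> \<zero>" if "s \<in> S" "s \<in> G 1" "s \<noteq> \<zero>\<^bsub>L\<^esub>" for s
  proof -
    have "\<alpha> s \<noteq> \<zero> \<or> \<beta> s \<noteq> \<zero>"
      using degree1[OF that(1,2)] that(3) by auto
    then show ?thesis using \<alpha>(1) \<beta>(1) by blast
  qed
  obtain \<phi> \<psi> where char: "lie_character K T \<phi>" "lie_character K T \<psi>" and nz: "\<phi> c \<noteq> \<zero>" "\<psi> d \<noteq> \<zero>"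
    using ex S assms \<open>d \<noteq> \<zero>\<^bsub>L\<^esub>\<close> by metis
  have "c \<in> span2 a b" "d \<in> span2 a b"
    using component_S(1)[OF S(1)] component_S(1)[OF S(2)] assms by (simp_all add: component_homogeneous)
  then have "d \<otimes>\<^bsub>L\<^esub> c = \<zero>\<^bsub>L\<^esub>" by (rule span2_bracket[OF gens_carrier(1,2) ab, rotated])
  moreover have "\<zero>\<^bsub>L\<^esub> \<in> C" "\<zero>\<^bsub>L\<^esub> \<in> D"
    using lie_subalgebraD(2) CD_subalgebras by auto
  \<comment> \<open>The second pair in \<open>bracket_factors\<close> is taken to be zero, so the
    right-hand side vanishes.\<close>
  ultimately have "\<psi> d \<otimes> \<phi> c = \<psi> \<zero>\<^bsub>L\<^esub> \<otimes> \<phi> \<zero>\<^bsub>L\<^esub>"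
    using bracket_factors[OF char assms(1) _ assms(4), of "\<zero>\<^bsub>L\<^esub>" "\<zero>\<^bsub>L\<^esub>"]
    by (simp add: a_minus_def minus_eq_smult)
  moreover have "\<zero>\<^bsub>L\<^esub> \<in> S" using lie_subalgebraD(2)[OF subalgebra_S] .
  then have "\<phi> \<zero>\<^bsub>L\<^esub> = \<zero>" "\<psi> \<zero>\<^bsub>L\<^esub> \<in> carrier K"
    using lie_characterD(3)[OF char(1), of \<zero> "\<zero>\<^bsub>L\<^esub>"] lie_characterD(1)[OF char(1), of "\<zero>\<^bsub>L\<^esub>"]
      lie_characterD(1)[OF char(2), of "\<zero>\<^bsub>L\<^esub>"] by auto
  ultimately have "\<psi> d \<otimes> \<phi> c = \<zero>" by simp
  moreover have "\<psi> d \<in> carrier K" "\<phi> c \<in> carrier K"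
    using lie_characterD(1)[OF char(1)] lie_characterD(1)[OF char(2)] S by auto
  ultimately show False using nz K.integral by blast
qed

lemma factor_trivial:
  assumes D1: "\<And>d. \<lbrakk> d \<in> D; d \<in> G 1 \<rbrakk> \<Longrightarrow> d = \<zero>\<^bsub>L\<^esub>"
  shows "D = {\<zero>\<^bsub>L\<^esub>}"
proof -
  note C_sub = lie_subalgebraD[OF CD_subalgebras(1)] and D_sub = lie_subalgebraD[OF CD_subalgebras(3)]
  have [simp]: "u \<in> carrier L" if "u \<in> C \<or> u \<in> D" for u using that C_sub(1) D_sub(1) by auto
  have C1: "s \<in> C" if s: "s \<in> S" "s \<in> G 1" for s
  proof -
    obtain c d where "c \<in> C" "d \<in> D" "d \<in> G 1" "component 1 s = c \<oplus>\<^bsub>L\<^esub> d"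
      using component_split[OF s(1), of 1] by auto
    then show ?thesis using D1[of d] s by (simp add: component_homogeneous)
  qed
  have aC: "a \<in> C" and bC: "b \<in> C" using C1 gens_S a b by auto
  obtain e d where ed: "e \<in> C" "d \<in> D" "d \<in> G 2" "z = e \<oplus>\<^bsub>L\<^esub> d"
    using component_split[OF gens_S(3), of 2] z by (auto simp: component_homogeneous)
  obtain e' d' where ed': "e' \<in> C" "d' \<in> D" "d' \<in> G 2" "t = e' \<oplus>\<^bsub>L\<^esub> d'"
    using component_split[OF gens_S(4), of 2] t by (auto simp: component_homogeneous)
  define P Q P' Q' where "P = e \<otimes>\<^bsub>L\<^esub> b" and "Q = d \<otimes>\<^bsub>L\<^esub> b"
    and "P' = e' \<otimes>\<^bsub>L\<^esub> a" and "Q' = d' \<otimes>\<^bsub>L\<^esub> a"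
  have PC: "P \<in> C" "P' \<in> C" using C_sub(5) ed ed' aC bC by (auto simp: P_def P'_def)
  have [simp]: "Q \<in> carrier L" "Q' \<in> carrier L" using ed ed' by (auto simp: Q_def Q'_def bracket_closed)
  have "P \<oplus>\<^bsub>L\<^esub> Q = P' \<oplus>\<^bsub>L\<^esub> Q'"
    using zb_ta ed ed' by (simp add: bracket_add_left P_def Q_def P'_def Q'_def)
  then have "Q = \<ominus>\<^bsub>L\<^esub> P \<oplus>\<^bsub>L\<^esub> (P' \<oplus>\<^bsub>L\<^esub> Q')"
    using PC L.M.r_neg1[of P Q] by simp
  then have "Q \<ominus>\<^bsub>L\<^esub> Q' = \<ominus>\<^bsub>L\<^esub> P \<oplus>\<^bsub>L\<^esub> P'"
    using PC by (simp add: a_minus_def L.M.a_assoc L.M.r_neg)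
  also have "\<dots> \<in> C" using PC C_sub(3,4) by (simp add: minus_eq_smult)
  finally have QQ: "d \<otimes>\<^bsub>L\<^esub> b \<ominus>\<^bsub>L\<^esub> d' \<otimes>\<^bsub>L\<^esub> a \<in> C" by (simp add: Q_def Q'_def)
  have zero: "\<psi> d = \<zero> \<and> \<psi> d' = \<zero>" if \<psi>: "lie_character K T \<psi>" for \<psi>
  proof -
    have "\<psi> d \<in> carrier K" "\<psi> d' \<in> carrier K"
      using lie_characterD(1)[OF \<psi>] ed(2) ed'(2) CD_subalgebras(4) by auto
    then show ?thesis
      \<comment> \<open>The equation is
        \<open>\<psi> d \<otimes> \<phi> b = \<psi> d' \<otimes> \<phi> a\<close>. Taking
        \<open>\<alpha>\<close> for \<open>\<phi>\<close> isolates \<open>\<psi> d'\<close>, and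
        taking \<open>\<beta>\<close> isolates \<open>\<psi> d\<close>.\<close>
      using bracket_factors[OF \<alpha>(1) \<psi> bC aC ed(2) ed'(2) QQ, symmetric]
        bracket_factors[OF \<beta>(1) \<psi> bC aC ed(2) ed'(2) QQ] by (simp add: \<alpha>(2,3) \<beta>(2,3))
  qed
  \<comment> \<open>In degree two the values of \<open>\<gamma>\<close> and \<open>\<delta>\<close>
    are the coefficients, and both are zero.\<close>
  have "d = \<zero>\<^bsub>L\<^esub>" "d' = \<zero>\<^bsub>L\<^esub>"
    using degree2[of d] degree2[of d'] zero[OF \<gamma>(1)] zero[OF \<delta>(1)] ed ed' CD_subalgebras(4) by auto
  then have "z \<in> C" "t \<in> C" using ed ed' by auto
  then have "S \<subseteq> C" unfolding S using aC bC CD_subalgebras(1) by (intro hull_minimal) auto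
  then have "C \<inter> D = D" using CD_subalgebras(4) by auto
  then show ?thesis using split by (simp add: free_splitting_def)
qed

end

theorem not_free_splitting:
  assumes C: "graded_lie_subalgebra K T (\<lambda>i. S \<inter> G i) C"
    and D: "graded_lie_subalgebra K T (\<lambda>i. S \<inter> G i) D"
    and nz: "C \<noteq> {\<zero>\<^bsub>L\<^esub>}" "D \<noteq> {\<zero>\<^bsub>L\<^esub>}"
  shows "\<not> is_free_product K T C D"
proof
  assume "is_free_product K T C D"
  then have split: "free_splitting K T C D"
    using C D lie_algebra.free_splittingI[OF lie_algebra_T] by (simp add: graded_lie_subalgebra_def)
  show False
    \<comment> \<open>Either \<open>C\<close> has a non-zero element of degree one, and then
      \<open>D\<close> has none and is trivial, or it has no such element and is trivial itself by
      symmetry.\<close>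
    using factor_trivial[OF C D split] factor_trivial[OF D C free_splitting_sym[OF split]]
      degree1_factor_trivial[OF C D split] nz by metis
qed

end

text \<open>Put \<open>\<xi>\<close> on the first axis and \<open>\<chi>\<close> on the second. As
  \<open>\<xi> x\<close> is one, bracketing with \<open>x\<close> moves the value of
  \<open>\<chi>\<close> from the second axis to the corner with sign plus. The two coordinates
  become characters only after restriction to \<open>S\<close>: on the whole coproduct the corner
  sees the bracket of \<open>x\<close> with \<open>a\<close>.\<close>

lemma (in lie_coproduct) coprod_characters:
  assumes \<chi>: "lie_character K C \<chi>" and \<xi>: "lie_character K D \<xi>" "\<xi> x = \<one>"
    and ab: "a \<in> carrier C" "b \<in> carrier C" and x: "x \<in> carrier D"
    and L: "L = lie_coprod K C D"
    and S: "S = lie_subalgebra K L hull {coprod_inl K C D a, coprod_inl K C D b,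
      coprod_inr K C D x \<otimes>\<^bsub>L\<^esub> coprod_inl K C D a, coprod_inr K C D x \<otimes>\<^bsub>L\<^esub> coprod_inl K C D b}"
  obtains \<alpha> \<gamma> where "lie_character K (L\<lparr>carrier := S\<rparr>) \<alpha>" "lie_character K (L\<lparr>carrier := S\<rparr>) \<gamma>"
    "\<alpha> (coprod_inl K C D a) = \<chi> a" "\<alpha> (coprod_inl K C D b) = \<chi> b"
    "\<gamma> (coprod_inr K C D x \<otimes>\<^bsub>L\<^esub> coprod_inl K C D a) = \<chi> a"
    "\<gamma> (coprod_inr K C D x \<otimes>\<^bsub>L\<^esub> coprod_inl K C D b) = \<chi> b"
proof -
  interpret L: lie_algebra K L unfolding L by (rule lie_algebra_coprod)
  let ?a = "coprod_inl K C D a" and ?b = "coprod_inl K C D b" and ?x = "coprod_inr K C D x"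
  have [simp]: "?a \<in> carrier L" "?b \<in> carrier L" "?x \<in> carrier L"
    unfolding L using lie_homD(1)[OF lie_hom_coprod_inl] lie_homD(1)[OF lie_hom_coprod_inr] ab x by auto
  have [simp]: "\<chi> a \<in> carrier K" "\<chi> b \<in> carrier K" using lie_characterD(1)[OF \<chi>] ab by auto
  obtain h where h: "h \<in> lie_hom K L (heis K)"
    and hl: "\<And>c. c \<in> carrier C \<Longrightarrow> h (coprod_inl K C D c) = (\<zero>, \<chi> c, \<zero>)"
    and hr: "\<And>d. d \<in> carrier D \<Longrightarrow> h (coprod_inr K C D d) = (\<xi> d, \<zero>, \<zero>)"
    unfolding L using coprod_lift[OF lie_algebra_heis lie_hom_heis_q[OF \<chi>] lie_hom_heis_p[OF \<xi>(1)]]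
    by metis
  have h_gens: "h ?a = (\<zero>, \<chi> a, \<zero>)" "h ?b = (\<zero>, \<chi> b, \<zero>)"
    "h (?x \<otimes>\<^bsub>L\<^esub> ?a) = (\<zero>, \<zero>, \<chi> a)" "h (?x \<otimes>\<^bsub>L\<^esub> ?b) = (\<zero>, \<zero>, \<chi> b)"
    using ab x \<xi>(2) by (simp_all add: hl hr lie_homD(4)[OF h] a_minus_def)
  \<comment> \<open>Brackets always have first coordinate zero, so this is a subalgebra; it contains
    the four generators of \<open>S\<close> but not \<open>x\<close>.\<close>
  let ?P = "{u \<in> carrier L. fst (h u) = \<zero>}"
  have fst: "fst (p \<oplus>\<^bsub>heis K\<^esub> q) = fst p \<oplus> fst q" "fst (p \<otimes>\<^bsub>heis K\<^esub> q) = \<zero>"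
    "fst (\<kappa> \<odot>\<^bsub>heis K\<^esub> p) = \<kappa> \<otimes> fst p" for p q \<kappa>
    by (cases p; cases q; simp)+
  have "lie_subalgebra K L ?P"
    by (rule L.lie_subalgebraI)
      (auto simp: lie_homD(2-4)[OF h] fst L.lie_hom_zero_minus(1)[OF lie_algebra_heis h] L.bracket_closed)
  moreover have "{?a, ?b, ?x \<otimes>\<^bsub>L\<^esub> ?a, ?x \<otimes>\<^bsub>L\<^esub> ?b} \<subseteq> ?P"
    by (simp add: h_gens L.bracket_closed)
  ultimately have SP: "S \<subseteq> ?P" unfolding S by (intro hull_minimal)
  have "h \<in> lie_hom K (L\<lparr>carrier := S\<rparr>) (heis K)"
    using SP by (intro lie_homI) (auto simp: lie_homD(2-4)[OF h] subset_eq simp del: heis_simps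
      intro: lie_homD(1)[OF h])
  from lie_character_heis[OF this] SP
  have "lie_character K (L\<lparr>carrier := S\<rparr>) (\<lambda>u. fst (snd (h u)))"
    "lie_character K (L\<lparr>carrier := S\<rparr>) (\<lambda>u. snd (snd (h u)))" by auto
  then show thesis by (rule that) (simp_all add: h_gens)
qed

theorem lemma6p4:
  fixes K :: "('a, 'k) ring_scheme"
    and M :: "('a, 'b, 'm) module_scheme"
    and N :: "('a, 'c, 'n) module_scheme"
    and a\<^sub>0 b\<^sub>0 :: 'b and x\<^sub>0 :: 'c
    and L :: "('a, ('a, 'b + 'c) lie_term set set) module"
    and a b x z t :: "('a, 'b + 'c) lie_term set set"
    and G :: "nat \<Rightarrow> ('a, 'b + 'c) lie_term set set set"
    and S :: "('a, 'b + 'c) lie_term set set set"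
  assumes "field K"
    and "lie_algebra K M" and "lie_abelian M" and "finite_basis K M {a\<^sub>0, b\<^sub>0}" and "a\<^sub>0 \<noteq> b\<^sub>0"
    and "lie_algebra K N" and "lie_abelian N" and "finite_basis K N {x\<^sub>0}"
    and "L = lie_coprod K M N"
    and "a = coprod_inl K M N a\<^sub>0" and "b = coprod_inl K M N b\<^sub>0" and "x = coprod_inr K M N x\<^sub>0"
    and "lie_grading K L G" and "a \<in> G 1" and "b \<in> G 1" and "x \<in> G 1"
    and "z = x \<otimes>\<^bsub>L\<^esub> a" and "t = x \<otimes>\<^bsub>L\<^esub> b"
    and "S = lie_subalgebra K L hull {a, b, z, t}"
  shows "\<forall>C D. graded_lie_subalgebra K (L\<lparr>carrier := S\<rparr>) (\<lambda>i. S \<inter> G i) C \<longrightarrow>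
    graded_lie_subalgebra K (L\<lparr>carrier := S\<rparr>) (\<lambda>i. S \<inter> G i) D \<longrightarrow>
    C \<noteq> {\<zero>\<^bsub>L\<^esub>} \<longrightarrow> D \<noteq> {\<zero>\<^bsub>L\<^esub>} \<longrightarrow>
    \<not> is_free_product K (L\<lparr>carrier := S\<rparr>) C D"
proof -
  interpret lie_coproduct K M N using assms by (intro lie_coproduct.intro)
  interpret L: graded_lie_algebra K L G
    using lie_algebra_coprod assms by (simp add: graded_lie_algebra_def graded_lie_algebra_axioms_def)
  have basis: "a\<^sub>0 \<in> carrier M" "b\<^sub>0 \<in> carrier M" "x\<^sub>0 \<in> carrier N"
    using assms(4,8) by (auto simp: finite_basis_def)
  have cl: "a \<in> carrier L" "b \<in> carrier L" "x \<in> carrier L"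
    using L.G_closed(1)[of 1] assms(14-16) by auto
  have S: "S = lie_subalgebra K L hull {coprod_inl K M N a\<^sub>0, coprod_inl K M N b\<^sub>0,
      coprod_inr K M N x\<^sub>0 \<otimes>\<^bsub>L\<^esub> coprod_inl K M N a\<^sub>0, coprod_inr K M N x\<^sub>0 \<otimes>\<^bsub>L\<^esub> coprod_inl K M N b\<^sub>0}"
    using assms(10-12,17-19) by simp
  obtain \<xi> where \<xi>: "lie_character K N \<xi>" "\<xi> x\<^sub>0 = \<one>\<^bsub>K\<^esub>"
    using D.dual_basis[OF assms(8) _ assms(7)] by auto
  obtain \<chi>\<^sub>a where \<chi>\<^sub>a: "lie_character K M \<chi>\<^sub>a" "\<chi>\<^sub>a a\<^sub>0 = \<one>\<^bsub>K\<^esub>" "\<chi>\<^sub>a b\<^sub>0 = \<zero>\<^bsub>K\<^esub>"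
    using C.dual_basis[OF assms(4) _ assms(3), of a\<^sub>0] assms(5) by auto
  obtain \<chi>\<^sub>b where \<chi>\<^sub>b: "lie_character K M \<chi>\<^sub>b" "\<chi>\<^sub>b b\<^sub>0 = \<one>\<^bsub>K\<^esub>" "\<chi>\<^sub>b a\<^sub>0 = \<zero>\<^bsub>K\<^esub>"
    using C.dual_basis[OF assms(4)[unfolded insert_commute[of a\<^sub>0]] _ assms(3), of b\<^sub>0] assms(5) by auto
  \<comment> \<open>The coordinate at \<open>a\<^sub>0\<close> produces the forms dual to
    \<open>a\<close> and \<open>z\<close> together; the one at \<open>b\<^sub>0\<close> produces
    those dual to \<open>b\<close> and \<open>t\<close>.\<close>
  obtain \<alpha> \<gamma> where \<alpha>: "lie_character K (L\<lparr>carrier := S\<rparr>) \<alpha>" "\<alpha> a = \<one>\<^bsub>K\<^esub>" "\<alpha> b = \<zero>\<^bsub>K\<^esub>"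
    and \<gamma>: "lie_character K (L\<lparr>carrier := S\<rparr>) \<gamma>" "\<gamma> z = \<one>\<^bsub>K\<^esub>" "\<gamma> t = \<zero>\<^bsub>K\<^esub>"
    using coprod_characters[OF \<chi>\<^sub>a(1) \<xi> basis assms(9) S] \<chi>\<^sub>a(2,3) assms(10-12,17,18) by metis
  obtain \<beta> \<delta> where \<beta>: "lie_character K (L\<lparr>carrier := S\<rparr>) \<beta>" "\<beta> a = \<zero>\<^bsub>K\<^esub>" "\<beta> b = \<one>\<^bsub>K\<^esub>"
    and \<delta>: "lie_character K (L\<lparr>carrier := S\<rparr>) \<delta>" "\<delta> z = \<zero>\<^bsub>K\<^esub>" "\<delta> t = \<one>\<^bsub>K\<^esub>"
    using coprod_characters[OF \<chi>\<^sub>b(1) \<xi> basis assms(9) S] \<chi>\<^sub>b(2,3) assms(10-12,17,18) by metis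
  have "a \<otimes>\<^bsub>L\<^esub> b = coprod_inl K M N (a\<^sub>0 \<otimes>\<^bsub>M\<^esub> b\<^sub>0)"
    using lie_homD(4)[OF lie_hom_coprod_inl] basis assms(9-11) by simp
  also have "\<dots> = coprod_inl K M N \<zero>\<^bsub>M\<^esub>" using assms(3) basis by (simp add: lie_abelian_def)
  also have "\<dots> = \<zero>\<^bsub>L\<^esub>"
    using C.lie_hom_zero_minus(1)[OF lie_algebra_coprod lie_hom_coprod_inl] assms(9) by simp
  finally have ab: "a \<otimes>\<^bsub>L\<^esub> b = \<zero>\<^bsub>L\<^esub>" .
  have zb_ta: "z \<otimes>\<^bsub>L\<^esub> b = t \<otimes>\<^bsub>L\<^esub> a"
    unfolding assms(17,18) by (rule L.bracket_commuting[OF cl ab])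
  have "z \<in> G 2" "t \<in> G 2"
    using L.G_bracket[of 1 1] assms(14-18) by (auto simp: numeral_2_eq_2)
  then interpret indecomposable_setting K L G a b z t S \<alpha> \<beta> \<gamma> \<delta>
    using assms(14,15,19) ab zb_ta \<alpha> \<beta> \<gamma> \<delta>
    by unfold_locales
  show ?thesis using not_free_splitting by blast
qed

end
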